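(* Let $D = x\frac{d}{dx}$, so that $(q^{\pm D}f)(x) = f(q^{\pm 1}x)$, and let $A$ be the $q$-difference operator $$A = (1-q^{1/2}x)\,q^{D} + q^{1/2}x + Qq^{1/2}x + Qx^2(1-q^{-1/2}x)^{-1}q^{-D}.$$ Then the single-variate specialization $Z(x)$ of the deformed melting crystal partition function $Z(t_1,t_2,\ldots)$, obtained by setting $t_k = -\frac{q^{-k/2}x^k}{k}$ for all $k\ge 1$, satisfies $$(A-1)Z(x) = 0.$$
   Context: Here $q$ is a complex number with $0<|q|<1$ and a fixed square root $q^{1/2}$. $\mathcal{P}$ is the set of all partitions $\lambda=(\lambda_1\ge\lambda_2\ge\cdots\ge 0)$ with finitely many nonzero parts, and $|\lambda|=\sum_i\lambda_i$. $s_\lambda(q^{-\rho})$ is the value of the Schur function $s_\lambda(x_1,x_2,\ldots)$ at $x_i=q^{i-1/2}$, $i=1,2,\ldots$. The deformed partition function is $$Z(t_1,t_2,\ldots)=\sum_{\lambda\in\mathcal{P}}s_\lambda(q^{-\rho})^2Q^{|\lambda|}\exp\Big(\sum_{k=1}^\infty t_k\phi_k(\lambda)\Big),\qquad \phi_k(\lambda)=\sum_{i=1}^\infty\big(q^{k(\lambda_i-i+1)}-q^{k(-i+1)}\big),$$ where the sum defining $\phi_k(\lambda)$ has finitely many nonzero terms. $Z(t_1,t_2,\ldots)$ is regarded as a formal power series in $Q$ and the $t_k$'s, $Z(x)$ as a formal power series in $Q$ with coefficients in $\mathbb{C}[[x]]$, and $(1-q^{-1/2}x)^{-1}$ is expanded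 as a geometric series in $x$. *)

theory Defs
  imports "HOL-Analysis.Analysis" "HOL-Computational_Algebra.Formal_Power_Series"
begin

text \<open>
  Sequences that are indexed by $1, 2, \ldots$ in the mathematical text are indexed from
  $0$ here, except for the coupling constants $t_k$ and the functions $\phi_k$: the part
  $\lambda_i$ of a partition is \<open>lam (i - 1)\<close>, and the variable $x_i$ of a Schur function
  is \<open>x (i - 1)\<close>.
\<close>

definition partitions :: "(nat \<Rightarrow> nat) set" where
  "partitions = {lam. antimono lam \<and> finite {i. lam i \<noteq> 0}}"

definition weight :: "(nat \<Rightarrow> nat) \<Rightarrow> nat" where
  "weight lam = (\<Sum>i | lam i \<noteq> 0. lam i)"

definition diagram :: "(nat \<Rightarrow> nat) \<Rightarrow> (nat \<times> nat) set" where
  "diagram lam = {(i, j). j < lam i}"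

text \<open>
  Semistandard tableaux, with entries in \<open>{0, 1, \<dots>}\<close>: the entry \<open>m\<close> stands for the
  variable \<open>x m\<close>.  Outside the diagram a tableau takes the value \<open>undefined\<close>, so that
  every tableau is counted once.
\<close>

definition ssyt :: "(nat \<Rightarrow> nat) \<Rightarrow> (nat \<times> nat \<Rightarrow> nat) set" where
  "ssyt lam = {T \<in> diagram lam \<rightarrow>\<^sub>E UNIV.
     (\<forall>i j. (i, Suc j) \<in> diagram lam \<longrightarrow> T (i, j) \<le> T (i, Suc j)) \<and>
     (\<forall>i j. (Suc i, j) \<in> diagram lam \<longrightarrow> T (i, j) < T (Suc i, j))}"

text \<open>
  The value of the Schur function in infinitely many variables.  The sum over tableaux
  converges absolutely whenever \<open>x\<close> is absolutely summable.
\<close>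

definition schur :: "(nat \<Rightarrow> nat) \<Rightarrow> (nat \<Rightarrow> complex) \<Rightarrow> complex" where
  "schur lam x = (\<Sum>\<^sub>\<infinity>T\<in>ssyt lam. \<Prod>c\<in>diagram lam. x (T c))"

text \<open>
  The parameter \<open>r\<close> is the chosen square root of \<open>q\<close>, so that $q^{i-1/2}$ (for $i \ge 1$)
  is \<open>r ^ (2 * (i - 1) + 1)\<close>.
\<close>

definition schur_rho :: "complex \<Rightarrow> (nat \<Rightarrow> nat) \<Rightarrow> complex" where
  "schur_rho r lam = schur lam (\<lambda>i. r ^ (2 * i + 1))"

text \<open>The terms of $\phi_k(\lambda)$ with $\lambda_i = 0$ vanish.\<close>

definition phi :: "complex \<Rightarrow> nat \<Rightarrow> (nat \<Rightarrow> nat) \<Rightarrow> complex" where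
  "phi q k lam = (\<Sum>i | lam i \<noteq> 0.
     q powi (int k * (int (lam i) - int i)) - q powi (int k * (- int i)))"

text \<open>
  Power series in $Q$ with coefficients in $\mathbb{C}[[x]]$ are elements of
  \<open>complex fps fps\<close>; here $x$ is \<open>fps_X :: complex fps\<close>, $Q$ is
  \<open>fps_X :: complex fps fps\<close>, and \<open>fps_const\<close> embeds $\mathbb{C}$ into
  $\mathbb{C}[[x]]$ and $\mathbb{C}[[x]]$ into $\mathbb{C}[[x]][[Q]]$.

  The partition function is taken at couplings \<open>t k\<close> ($k \ge 1$; \<open>t 0\<close> is not used) in
  $\mathbb{C}[[x]]$.  This is the substitution into the formal power series
  $Z(t_1, t_2, \ldots)$ if every \<open>t k\<close> has zero constant term and \<open>t k\<close> tends to \<open>0\<close> in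
  the $x$-adic topology, which is the topology of the infinite sum over \<open>k\<close> below.  The
  exponential of a power series without constant term is its composition with
  \<open>fps_exp 1\<close>.
\<close>

definition Z_deformed :: "complex \<Rightarrow> complex \<Rightarrow> (nat \<Rightarrow> complex fps) \<Rightarrow> complex fps fps" where
  "Z_deformed q r t = Abs_fps (\<lambda>n. \<Sum>lam | lam \<in> partitions \<and> weight lam = n.
     fps_const ((schur_rho r lam)\<^sup>2) *
     (fps_exp 1 oo (\<Sum>k. t (Suc k) * fps_const (phi q (Suc k) lam))))"

definition Z_single :: "complex \<Rightarrow> complex \<Rightarrow> complex fps fps" where
  "Z_single q r = Z_deformed q r (\<lambda>k. - (fps_const (inverse r ^ k / of_nat k) * fps_X ^ k))"

text \<open>
  For $D = x\,d/dx$ the operator \<open>q_pow_D c\<close> is $c^D$, that is, $f(x) \mapsto f(cx)$,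
  applied to each coefficient of a power series in $Q$.
\<close>

definition q_pow_D :: "complex \<Rightarrow> complex fps fps \<Rightarrow> complex fps fps" where
  "q_pow_D c F = Abs_fps (\<lambda>n. fps_nth F n oo (fps_const c * fps_X))"

definition A_op :: "complex \<Rightarrow> complex \<Rightarrow> complex fps fps \<Rightarrow> complex fps fps" where
  "A_op q r F =
     fps_const (1 - fps_const r * fps_X) * q_pow_D q F
     + fps_const (fps_const r * fps_X) * F
     + fps_X * fps_const (fps_const r * fps_X) * F
     + fps_X * fps_const (fps_X\<^sup>2 * inverse (1 - fps_const (inverse r) * fps_X))
         * q_pow_D (inverse q) F"

end

theory Submission
  imports Defs "Jordan_Normal_Form.Determinant" "HOL-Computational_Algebra.Polynomial_FPS"
begin

text \<open>
  At the given couplings the exponential factor of \<open>lam\<close> becomes the rational function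
  $F_\lambda(x) = \prod_i (1 - x q^{\lambda_i-i+1/2}) / (1 - x q^{-i+1/2})$.  Both
  $(1 - q^{1/2}x) F_\lambda(qx) / F_\lambda(x)$ and
  $F_\mu(q^{-1}x) / ((1 - q^{-1/2}x) F_\mu(x))$ are rational functions with simple poles; the
  poles of the first belong to the removable boxes of $\lambda$, those of the second to the
  addable boxes of $\mu$.  Since the principal specialization of a Schur function is a product
  over pairs of rows, the residues are $(1 - q) s_\mu / s_\lambda$ and
  $(1 - q) s_\lambda / s_\mu$, where $\mu$ and $\lambda$ differ by the box in question.
  Summing the partial fraction expansions against $s_\lambda^2$ and $s_\mu^2$ gives two sums over
  pairs of partitions that differ by one box.  They agree term by term, and this is the equation
  for the coefficient of $Q^{|\lambda|}$.

  The product formula for Schur functions in finitely many variables follows by induction on the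
  number of variables: removing the largest entry of a tableau turns the sum over interlacing
  partitions into a determinant of geometric sums, that is, again a Vandermonde determinant.
\<close>

section \<open>Vandermonde determinants\<close>

text \<open>Written as (1 - q^(1/2) x)(q^D - 1) + Q x (q^(1/2) + x (1 - q^(-1/2) x)^(-1) q^(-D)),
  the operator A - 1 separates into a part that keeps the weight and a part that raises it by one. A
  dilation of x shifts the empty-row denominators of F_lambda by one row, and the prefactors (1 -
  q^(1/2) x) and (1 - q^(-1/2) x)^(-1) absorb the row that sticks out. The q^(1/2) in the second
  part cancels the value at infinity of the addable expansion, so that only poles remain. The square
  of the Schur value makes the two sides match: the residue exchanges one of the two factors, and
  both sides carry (1 - q) s_lambda s_mu. All products are cut off after finitely many rows; the
  empty row with index M keeps what is left of the tail.\<close>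

lemma power_newton_expansion:
  fixes a :: "nat \<Rightarrow> 'a::comm_ring_1"
  shows "\<exists>u. (\<forall>k>n. u k = 0) \<and> u n = 1 \<and> (\<forall>x. x ^ n = (\<Sum>k\<le>n. u k * (\<Prod>l<k. x - a l)))"
proof (induction n)
  case 0
  show ?case by (rule exI[of _ "\<lambda>k. if k = 0 then 1 else 0"]) auto
next
  case (Suc n)
  then obtain u where u: "\<forall>k>n. u k = 0" "u n = 1"
    "\<And>x. x ^ n = (\<Sum>k\<le>n. u k * (\<Prod>l<k. x - a l))" by auto
  \<comment> \<open>From x N_k = N_(k+1) + a_k N_k for the Newton products N_k.\<close>
  define v where "v k = (if k = 0 then 0 else u (k - 1)) + a k * u k" for k
  have "x ^ Suc n = (\<Sum>k\<le>Suc n. v k * (\<Prod>l<k. x - a l))" for x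
  proof -
    have "x ^ Suc n = (\<Sum>k\<le>n. u k * (x * (\<Prod>l<k. x - a l)))"
      by (simp add: u(3) sum_distrib_left mult_ac)
    also have "\<dots> = (\<Sum>k\<le>n. u k * (\<Prod>l<Suc k. x - a l)) + (\<Sum>k\<le>n. a k * u k * (\<Prod>l<k. x - a l))"
      by (simp add: sum.distrib [symmetric] algebra_simps)
    also have "(\<Sum>k\<le>n. a k * u k * (\<Prod>l<k. x - a l)) = (\<Sum>k\<le>Suc n. a k * u k * (\<Prod>l<k. x - a l))"
      using u(1) by simp
    also have "(\<Sum>k\<le>n. u k * (\<Prod>l<Suc k. x - a l))
        = (\<Sum>k\<le>Suc n. (if k = 0 then 0 else u (k - 1)) * (\<Prod>l<k. x - a l))"
      by (subst sum.atMost_Suc_shift) simp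
    finally show ?thesis
      by (simp only: v_def sum.distrib [symmetric] distrib_right)
  qed
  then show ?case using u(1,2) by (intro exI[of _ v]) (auto simp: v_def)
qed

text \<open>Newton interpolation at the nodes themselves is an LU factorization: the k-th Newton
  product vanishes at node i for i < k, and the expansion coefficients, independent of x, form a
  unitriangular matrix.\<close>

lemma det_vandermonde:
  fixes a :: "nat \<Rightarrow> 'a::idom"
  shows "det (mat n n (\<lambda>(i, j). a i ^ j)) = (\<Prod>j<n. \<Prod>i<j. a j - a i)"
proof -
  obtain u where u: "\<And>j k. j < k \<Longrightarrow> u j k = 0" "\<And>j. u j j = 1"
    "\<And>j x. x ^ j = (\<Sum>k\<le>j. u j k * (\<Prod>l<k. x - a l))"
    using power_newton_expansion [of _ a] by metis
  define L where "L = mat n n (\<lambda>(i, k). \<Prod>l<k. a i - a l)"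
  define U where "U = mat n n (\<lambda>(k, j). u j k)"
  have LU: "L \<in> carrier_mat n n" "U \<in> carrier_mat n n" by (auto simp: L_def U_def)
  have "mat n n (\<lambda>(i, j). a i ^ j) = L * U"
  proof (rule eq_matI)
    fix i j assume "i < dim_row (L * U)" "j < dim_col (L * U)"
    then have ij: "i < n" "j < n" using LU by auto
    have "(L * U) $$ (i, j) = (\<Sum>k<n. (\<Prod>l<k. a i - a l) * u j k)"
      using ij by (simp add: L_def U_def scalar_prod_def atLeast0LessThan)
    also have "\<dots> = (\<Sum>k\<le>j. u j k * (\<Prod>l<k. a i - a l))"
      using ij u(1) by (intro sum.mono_neutral_cong_right) auto
    finally show "mat n n (\<lambda>(i, j). a i ^ j) $$ (i, j) = (L * U) $$ (i, j)"
      using ij u(3) by simp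
  qed (auto simp: L_def U_def)
  then have "det (mat n n (\<lambda>(i, j). a i ^ j)) = det L * det U"
    using LU by (simp add: det_mult)
  also have "det L = prod_list (diag_mat L)"
    by (rule det_lower_triangular [OF _ LU(1)]) (auto simp: L_def intro!: prod_zero)
  also have "\<dots> = (\<Prod>j<n. \<Prod>i<j. a j - a i)"
    by (simp add: prod_list_diag_prod L_def atLeast0LessThan)
  also have "det U = prod_list (diag_mat U)"
    by (rule det_upper_triangular [OF _ LU(2)]) (auto simp: U_def upper_triangular_def u(1))
  also have "\<dots> = 1"
    by (simp add: prod_list_diag_prod U_def u(2))
  finally show ?thesis by simp
qed

text \<open>Column 0 of the larger matrix is constantly 1. Subtracting from each row the next one
  leaves only the last entry of that column; the sign is that of the corner (n, 0) in the Laplace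
  expansion.\<close>

lemma det_consecutive_differences:
  fixes b :: "nat \<Rightarrow> 'a::idom"
  shows "det (mat n n (\<lambda>(i, j). b i ^ Suc j - b (Suc i) ^ Suc j))
    = (-1) ^ n * det (mat (Suc n) (Suc n) (\<lambda>(i, j). b i ^ j))"
proof -
  define V where "V = mat (Suc n) (Suc n) (\<lambda>(i, j). b i ^ j)"
  define T :: "'a mat" where "T = mat (Suc n) (Suc n)
    (\<lambda>(i, k). if k = i then 1 else if k = Suc i then -1 else 0)"
  define W where "W = mat (Suc n) (Suc n) (\<lambda>(i, j). if i < n then b i ^ j - b (Suc i) ^ j else b i ^ j)"
  have carr: "V \<in> carrier_mat (Suc n) (Suc n)" "T \<in> carrier_mat (Suc n) (Suc n)"
    "W \<in> carrier_mat (Suc n) (Suc n)" by (auto simp: V_def T_def W_def)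
  have "W = T * V"
  proof (rule eq_matI)
    fix i j assume "i < dim_row (T * V)" "j < dim_col (T * V)"
    then have ij: "i < Suc n" "j < Suc n" using carr by auto
    have "(T * V) $$ (i, j)
      = (\<Sum>k<Suc n. (if k = i then 1 else if k = Suc i then -1 else 0) * b k ^ j)"
      using ij by (simp add: T_def V_def scalar_prod_def atLeast0LessThan del: sum.lessThan_Suc)
    also have "\<dots> = (\<Sum>k<Suc n. if k = i then b k ^ j else 0) - (\<Sum>k<Suc n. if k = Suc i then b k ^ j else 0)"
      by (simp only: sum_subtractf [symmetric]) (rule sum.cong, auto)
    also have "\<dots> = W $$ (i, j)"
      using ij by (simp add: W_def del: sum.lessThan_Suc)
    finally show "W $$ (i, j) = (T * V) $$ (i, j)" ..
  qed (auto simp: T_def V_def W_def)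
  moreover have "det T = 1"
    using det_upper_triangular [OF _ carr(2)]
    by (simp add: upper_triangular_def prod_list_diag_prod T_def)
  ultimately have "det V = det W" using carr by (simp add: det_mult)
  also have "\<dots> = (\<Sum>i<Suc n. W $$ (i, 0) * cofactor W i 0)"
    using laplace_expansion_column [OF carr(3)] by simp
  also have "\<dots> = cofactor W n 0"
    by (simp add: W_def)
  also have "mat_delete W n 0 = mat n n (\<lambda>(i, j). b i ^ Suc j - b (Suc i) ^ Suc j)"
    by (rule eq_matI) (auto simp: mat_delete_def W_def)
  then have "cofactor W n 0 = (-1) ^ n * det (mat n n (\<lambda>(i, j). b i ^ Suc j - b (Suc i) ^ Suc j))"
    by (simp add: cofactor_def)
  finally show ?thesis
    by (simp add: V_def mult.assoc [symmetric] power_mult_distrib [symmetric])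
qed

text \<open>Multilinearity in the rows: the summation index of row i occurs in row i alone.\<close>

lemma det_sum_PiE:
  fixes g :: "nat \<Rightarrow> 'b \<Rightarrow> nat \<Rightarrow> 'a::comm_ring_1"
  assumes "\<And>i. finite (S i)"
  shows "(\<Sum>m\<in>Pi\<^sub>E {..<n} S. det (mat n n (\<lambda>(i, j). g i (m i) j)))
    = det (mat n n (\<lambda>(i, j). \<Sum>s\<in>S i. g i s j))"
proof -
  have "(\<Sum>m\<in>Pi\<^sub>E {..<n} S. det (mat n n (\<lambda>(i, j). g i (m i) j)))
    = (\<Sum>m\<in>Pi\<^sub>E {..<n} S. \<Sum>p\<in>{p. p permutes {0..<n}}. signof p * (\<Prod>i<n. g i (m i) (p i)))"
    by (intro sum.cong refl, subst det_def'[where n=n])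
      (auto intro!: sum.cong prod.cong simp: atLeast0LessThan dest: permutes_in_image)
  also have "\<dots> = (\<Sum>p\<in>{p. p permutes {0..<n}}. signof p * (\<Sum>m\<in>Pi\<^sub>E {..<n} S. \<Prod>i<n. g i (m i) (p i)))"
    by (subst sum.swap) (simp add: sum_distrib_left)
  also have "\<dots> = (\<Sum>p\<in>{p. p permutes {0..<n}}. signof p * (\<Prod>i<n. \<Sum>s\<in>S i. g i s (p i)))"
    using assms by (subst prod_sum_PiE) auto
  also have "\<dots> = det (mat n n (\<lambda>(i, j). \<Sum>s\<in>S i. g i s j))"
    by (subst det_def'[where n=n])
      (auto intro!: sum.cong prod.cong simp: atLeast0LessThan dest: permutes_in_image)
  finally show ?thesis .
qed

section \<open>Branching of tableaux\<close>

definition bounded_ssyt :: "nat \<Rightarrow> (nat \<Rightarrow> nat) \<Rightarrow> (nat \<times> nat \<Rightarrow> nat) set" where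
  "bounded_ssyt N lam = {T \<in> ssyt lam. \<forall>c\<in>diagram lam. T c < N}"

text \<open>Principal specialization at 1, q, ..., q^(N-1). The variables of
  \<open>schur_rho\<close> carry an extra factor \<open>r\<close> per box, restored in
  \<open>schur_rho_limit\<close>.\<close>

definition tableau_sum :: "complex \<Rightarrow> nat \<Rightarrow> (nat \<Rightarrow> nat) \<Rightarrow> complex" where
  "tableau_sum q N lam = (\<Sum>T\<in>bounded_ssyt N lam. \<Prod>c\<in>diagram lam. q ^ T c)"

text \<open>These shapes remain when the boxes with entry \<open>N\<close>, a horizontal strip, are
  deleted from a tableau with entries at most \<open>N\<close>.\<close>

definition interlacing :: "nat \<Rightarrow> (nat \<Rightarrow> nat) \<Rightarrow> (nat \<Rightarrow> nat) set" where
  "interlacing N lam = {mu. (\<forall>i<N. lam (Suc i) \<le> mu i \<and> mu i \<le> lam i) \<and> (\<forall>i\<ge>N. mu i = 0)}"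

lemma diagram_eq_Sigma:
  assumes "\<forall>i\<ge>M. lam i = 0"
  shows "diagram lam = Sigma {..<M} (\<lambda>i. {..<lam i})"
proof -
  have "j < lam i \<Longrightarrow> i < M" for i j using assms by (cases "i < M") auto
  then show ?thesis by (auto simp: diagram_def)
qed

lemma finite_diagram: "\<forall>i\<ge>M. lam i = 0 \<Longrightarrow> finite (diagram lam)"
  by (simp add: diagram_eq_Sigma)

lemma card_diagram: "\<forall>i\<ge>M. lam i = 0 \<Longrightarrow> card (diagram lam) = (\<Sum>i<M. lam i)"
  by (simp add: diagram_eq_Sigma)

lemma finite_bounded_ssyt:
  assumes "finite (diagram lam)"
  shows "finite (bounded_ssyt N lam)"
proof -
  have "bounded_ssyt N lam \<subseteq> diagram lam \<rightarrow>\<^sub>E {..<N}"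
    by (auto simp: bounded_ssyt_def ssyt_def PiE_iff extensional_def)
  then show ?thesis
    using assms by (meson finite_PiE finite_lessThan finite_subset)
qed

lemma ssyt_row_mono:
  assumes "T \<in> ssyt lam" "j' < lam i" "j \<le> j'"
  shows "T (i, j) \<le> T (i, j')"
  using assms(3,2)
proof (induction j' rule: dec_induct)
  case (step k)
  have "T (i, k) \<le> T (i, Suc k)"
    using assms(1) step.prems by (auto simp: ssyt_def diagram_def)
  with step show ?case by simp
qed simp

lemma ssyt_ge_row:
  assumes "T \<in> ssyt lam" "antimono lam" "j < lam i"
  shows "i \<le> T (i, j)"
  using assms(3)
proof (induction i)
  case (Suc i)
  have "lam (Suc i) \<le> lam i" using assms(2) by (simp add: antimonoD)
  with Suc have "i \<le> T (i, j)" by simp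
  moreover have "T (i, j) < T (Suc i, j)"
    using assms(1) Suc.prems by (auto simp: ssyt_def diagram_def)
  ultimately show ?case by simp
qed simp

lemma interlacing_antimono:
  assumes "antimono lam" "mu \<in> interlacing N lam"
  shows "antimono mu"
proof -
  have "mu (Suc i) \<le> mu i" for i
  proof (cases "Suc i < N")
    case True
    then have "mu (Suc i) \<le> lam (Suc i)" "lam (Suc i) \<le> mu i"
      using assms(2) by (auto simp: interlacing_def)
    then show ?thesis by simp
  next
    case False
    then show ?thesis using assms(2) by (simp add: interlacing_def)
  qed
  then show ?thesis by (simp add: decseq_SucI)
qed

section \<open>Deleting and restoring the largest entry\<close>

definition tableau_extension where
  "tableau_extension N lam mu U = (\<lambda>c. if c \<in> diagram mu then U c
     else if c \<in> diagram lam then N else undefined)"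

definition tableau_subshape where
  "tableau_subshape N lam T = (\<lambda>i. card {j. j < lam i \<and> T (i, j) < (N::nat)})"

text \<open>Rows increase weakly, so the entries below \<open>N\<close> fill an initial segment of
  each row, and counting them recovers it.\<close>

lemma less_tableau_subshape_iff:
  assumes "T \<in> ssyt lam"
  shows "j < tableau_subshape N lam T i \<longleftrightarrow> j < lam i \<and> T (i, j) < N"
proof -
  let ?A = "{j. j < lam i \<and> T (i, j) < N}"
  have fin: "finite ?A" by simp
  have down: "j' \<in> ?A" if "j \<in> ?A" "j' \<le> j" for j j'
    using that ssyt_row_mono [OF assms, of j i j'] by auto
  have "?A = {..<card ?A}"
  proof (cases "?A = {}")
    case False
    have "?A = {..Max ?A}"
    proof (intro equalityI subsetI)
      fix j assume "j \<in> ?A"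
      then show "j \<in> {..Max ?A}" using Max_ge [OF fin] by blast
    next
      fix j assume "j \<in> {..Max ?A}"
      then show "j \<in> ?A" using down [OF Max_in [OF fin False]] by blast
    qed
    moreover from this have "card ?A = Suc (Max ?A)" by (metis card_atMost)
    ultimately show ?thesis by (simp only: lessThan_Suc_atMost)
  next
    case True
    then show ?thesis by (simp only: card.empty lessThan_0)
  qed
  then have "j \<in> ?A \<longleftrightarrow> j \<in> {..<card ?A}" by (rule arg_cong)
  then show ?thesis by (simp add: tableau_subshape_def)
qed

lemma diagram_mono: "(\<And>i. mu i \<le> lam i) \<Longrightarrow> diagram mu \<subseteq> diagram lam"
  by (auto simp: diagram_def intro: less_le_trans)

lemma tableau_subshape_interlacing:
  assumes T: "T \<in> bounded_ssyt (Suc N) lam" and lam: "antimono lam"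
  shows "tableau_subshape N lam T \<in> interlacing N lam"
proof -
  have Ts: "T \<in> ssyt lam" using T by (simp add: bounded_ssyt_def)
  note iff = less_tableau_subshape_iff [OF Ts, of _ N]
  have "tableau_subshape N lam T i \<le> lam i" for i
    using iff [of "lam i" i] by (simp add: not_less [symmetric])
  \<comment> \<open>A box with a box below it has an entry smaller than one that is at most
    \<open>N\<close>, so it is kept.\<close>
  moreover have "lam (Suc i) \<le> tableau_subshape N lam T i" for i
  proof (rule ccontr)
    let ?j = "tableau_subshape N lam T i"
    assume "\<not> ?thesis"
    then have j: "?j < lam (Suc i)" by simp
    moreover have "lam (Suc i) \<le> lam i" using lam by (simp add: antimonoD)
    ultimately have "?j < lam i" by simp
    moreover have "T (i, ?j) < T (Suc i, ?j)"
      using Ts j by (auto simp: ssyt_def diagram_def)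
    moreover have "T (Suc i, ?j) < Suc N"
      using T j by (auto simp: bounded_ssyt_def diagram_def)
    ultimately show False using iff [of ?j i] by simp
  qed
  moreover have "tableau_subshape N lam T i = 0" if "i \<ge> N" for i
  proof (rule ccontr)
    assume "tableau_subshape N lam T i \<noteq> 0"
    then have "0 < lam i" "T (i, 0) < N" using iff [of 0 i] by auto
    then show False using ssyt_ge_row [OF Ts lam, of 0 i] that by simp
  qed
  ultimately show ?thesis by (simp add: interlacing_def)
qed

lemma tableau_extension_bounded_ssyt:
  assumes mu: "mu \<in> interlacing N lam" and lam: "antimono lam" "\<forall>i>N. lam i = 0"
    and U: "U \<in> bounded_ssyt N mu"
  shows "tableau_extension N lam mu U \<in> bounded_ssyt (Suc N) lam"
proof -
  let ?T = "tableau_extension N lam mu U"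
  have mu_anti: "antimono mu" by (rule interlacing_antimono [OF lam(1) mu])
  have le: "mu i \<le> lam i" for i
    using mu by (cases "i < N") (auto simp: interlacing_def)
  have U_less: "U c < N" if "c \<in> diagram mu" for c
    using U that by (auto simp: bounded_ssyt_def)
  have T_le: "?T c \<le> N" if "c \<in> diagram lam" for c
    using that U_less [of c] by (auto simp: tableau_extension_def)
  have "?T \<in> diagram lam \<rightarrow>\<^sub>E UNIV"
    using diagram_mono [of mu lam] le by (auto simp: tableau_extension_def)
  moreover have "?T (i, j) \<le> ?T (i, Suc j)" if "(i, Suc j) \<in> diagram lam" for i j
  proof (cases "(i, Suc j) \<in> diagram mu")
    case True
    then have "(i, j) \<in> diagram mu" by (simp add: diagram_def)
    with True show ?thesis using U by (auto simp: tableau_extension_def bounded_ssyt_def ssyt_def)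
  next
    case False
    then have "?T (i, Suc j) = N" using that by (simp add: tableau_extension_def)
    moreover have "(i, j) \<in> diagram lam" using that by (simp add: diagram_def)
    ultimately show ?thesis using T_le by simp
  qed
  moreover have "?T (i, j) < ?T (Suc i, j)" if *: "(Suc i, j) \<in> diagram lam" for i j
  proof -
    \<comment> \<open>Rows end at index \<open>N\<close>, so a box with a box below it lies in a row
      where interlacing puts it into \<open>mu\<close>; its entry is below \<open>N\<close>, while
      the lower one may be \<open>N\<close>.\<close>
    have "i < N" using * lam(2) by (cases "i < N") (auto simp: diagram_def)
    then have "(i, j) \<in> diagram mu"
      using * mu by (auto simp: diagram_def interlacing_def intro: less_le_trans)
    then have Tij: "?T (i, j) = U (i, j)" "U (i, j) < N"
      using U_less by (auto simp: tableau_extension_def)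
    show ?thesis
    proof (cases "(Suc i, j) \<in> diagram mu")
      case True
      then show ?thesis using U Tij by (auto simp: tableau_extension_def bounded_ssyt_def ssyt_def)
    next
      case False
      then show ?thesis using * Tij by (simp add: tableau_extension_def)
    qed
  qed
  ultimately show ?thesis
    using T_le by (auto simp: bounded_ssyt_def ssyt_def less_Suc_eq_le)
qed

lemma tableau_subshape_extension:
  assumes "mu \<in> interlacing N lam" "U \<in> bounded_ssyt N mu"
  shows "tableau_subshape N lam (tableau_extension N lam mu U) = mu"
proof
  fix i
  have le: "mu i \<le> lam i"
    using assms(1) by (cases "i < N") (auto simp: interlacing_def)
  have "{j. j < lam i \<and> tableau_extension N lam mu U (i, j) < N} = {..<mu i}"
    using assms(2) le by (auto simp: tableau_extension_def bounded_ssyt_def diagram_def)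
  then show "tableau_subshape N lam (tableau_extension N lam mu U) i = mu i"
    by (simp add: tableau_subshape_def)
qed

lemma restrict_bounded_ssyt:
  assumes T: "T \<in> bounded_ssyt (Suc N) lam" and lam: "antimono lam"
  shows "restrict T (diagram (tableau_subshape N lam T)) \<in> bounded_ssyt N (tableau_subshape N lam T)"
proof -
  let ?mu = "tableau_subshape N lam T"
  have Ts: "T \<in> ssyt lam" using T by (simp add: bounded_ssyt_def)
  have iff: "c \<in> diagram ?mu \<longleftrightarrow> c \<in> diagram lam \<and> T c < N" for c
    using less_tableau_subshape_iff [OF Ts, of "snd c" N "fst c"] by (cases c) (simp add: diagram_def)
  have anti: "antimono ?mu"
    by (rule interlacing_antimono [OF lam tableau_subshape_interlacing [OF assms]])
  have row: "T (i, j) \<le> T (i, Suc j) \<and> (i, j) \<in> diagram ?mu"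
    if "(i, Suc j) \<in> diagram ?mu" for i j
  proof -
    have "(i, Suc j) \<in> diagram lam" using that iff by simp
    then show ?thesis using Ts that by (simp add: ssyt_def diagram_def)
  qed
  have col: "T (i, j) < T (Suc i, j) \<and> (i, j) \<in> diagram ?mu"
    if "(Suc i, j) \<in> diagram ?mu" for i j
  proof -
    have "(Suc i, j) \<in> diagram lam" using that iff by simp
    moreover have "(i, j) \<in> diagram ?mu"
      using that antimonoD [OF anti, of i "Suc i"] by (auto simp: diagram_def)
    ultimately show ?thesis using Ts by (simp add: ssyt_def)
  qed
  have bound: "T c < N" if "c \<in> diagram ?mu" for c using that iff by simp
  let ?R = "restrict T (diagram ?mu)"
  have "?R \<in> diagram ?mu \<rightarrow>\<^sub>E UNIV" by simp
  moreover have "?R (i, j) \<le> ?R (i, Suc j)" if "(i, Suc j) \<in> diagram ?mu" for i j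
    using row [OF that] that by simp
  moreover have "?R (i, j) < ?R (Suc i, j)" if "(Suc i, j) \<in> diagram ?mu" for i j
    using col [OF that] that by simp
  moreover have "?R c < N" if "c \<in> diagram ?mu" for c
    using bound [OF that] that by simp
  ultimately show ?thesis
    unfolding bounded_ssyt_def ssyt_def by blast
qed

lemma tableau_extension_restrict:
  assumes T: "T \<in> bounded_ssyt (Suc N) lam"
  shows "tableau_extension N lam (tableau_subshape N lam T)
    (restrict T (diagram (tableau_subshape N lam T))) = T"
proof
  fix c
  have Ts: "T \<in> ssyt lam" using T by (simp add: bounded_ssyt_def)
  have iff: "c \<in> diagram (tableau_subshape N lam T) \<longleftrightarrow> c \<in> diagram lam \<and> T c < N"
    using less_tableau_subshape_iff [OF Ts, of "snd c" N "fst c"] by (cases c) (simp add: diagram_def)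
  have "T c < Suc N" if "c \<in> diagram lam" using T that by (auto simp: bounded_ssyt_def)
  moreover have "T c = undefined" if "c \<notin> diagram lam"
    using Ts that PiE_arb [of T "diagram lam" "\<lambda>_. UNIV" c] by (auto simp: ssyt_def)
  ultimately show "tableau_extension N lam (tableau_subshape N lam T)
    (restrict T (diagram (tableau_subshape N lam T))) c = T c"
    using iff by (auto simp: tableau_extension_def)
qed

lemma restrict_tableau_extension:
  assumes "U \<in> bounded_ssyt N mu"
  shows "restrict (tableau_extension N lam mu U) (diagram mu) = U"
  using assms
  by (auto simp: tableau_extension_def bounded_ssyt_def ssyt_def PiE_iff extensional_def fun_eq_iff)

lemma finite_interlacing: "finite (interlacing N lam)"
proof -
  have "inj_on (\<lambda>mu. restrict mu {..<N}) (interlacing N lam)"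
  proof (rule inj_onI, rule ext)
    fix mu nu i
    assume *: "mu \<in> interlacing N lam" "nu \<in> interlacing N lam"
      "restrict mu {..<N} = restrict nu {..<N}"
    have "restrict mu {..<N} i = restrict nu {..<N} i" by (simp only: *(3))
    then show "mu i = nu i"
      using *(1,2) by (cases "i < N") (simp_all add: interlacing_def)
  qed
  moreover have "(\<lambda>mu. restrict mu {..<N}) ` interlacing N lam \<subseteq> PiE {..<N} (\<lambda>i. {lam (Suc i)..lam i})"
    by (auto simp: interlacing_def split: if_splits)
  ultimately show ?thesis
    by (meson finite_PiE finite_atLeastAtMost finite_lessThan inj_on_finite)
qed

text \<open>A tableau amounts to the subshape \<open>mu\<close> of its entries below
  \<open>N\<close> together with a tableau on \<open>mu\<close>; every deleted box contributes
  \<open>q ^ N\<close>.\<close>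

lemma tableau_sum_Suc:
  assumes lam: "antimono lam" "\<forall>i>N. lam i = 0"
  shows "tableau_sum q (Suc N) lam = (\<Sum>mu\<in>interlacing N lam.
    tableau_sum q N mu * q ^ (N * ((\<Sum>i<Suc N. lam i) - (\<Sum>i<N. mu i))))"
proof -
  let ?S = "SIGMA mu:interlacing N lam. bounded_ssyt N mu"
  have zero_mu: "\<forall>i\<ge>N. mu i = 0" if "mu \<in> interlacing N lam" for mu
    using that by (simp add: interlacing_def)
  have le: "mu i \<le> lam i" if "mu \<in> interlacing N lam" for mu i
    using that by (cases "i < N") (auto simp: interlacing_def)
  have zero_lam: "\<forall>i\<ge>Suc N. lam i = 0" using lam(2) by auto
  have weight: "(\<Prod>c\<in>diagram lam. q ^ tableau_extension N lam mu U c)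
      = (\<Prod>c\<in>diagram mu. q ^ U c) * q ^ (N * ((\<Sum>i<Suc N. lam i) - (\<Sum>i<N. mu i)))"
    if mu: "mu \<in> interlacing N lam" for mu U
  proof -
    have sub: "diagram mu \<subseteq> diagram lam" by (rule diagram_mono) (rule le [OF mu])
    have fin: "finite (diagram lam)" by (rule finite_diagram [OF zero_lam])
    have "(\<Prod>c\<in>diagram lam. q ^ tableau_extension N lam mu U c)
      = (\<Prod>c\<in>diagram mu. q ^ tableau_extension N lam mu U c)
        * (\<Prod>c\<in>diagram lam - diagram mu. q ^ tableau_extension N lam mu U c)"
      using prod.subset_diff [OF sub fin, of "\<lambda>c. q ^ tableau_extension N lam mu U c"]
      by (simp add: mult.commute)
    also have "(\<Prod>c\<in>diagram mu. q ^ tableau_extension N lam mu U c) = (\<Prod>c\<in>diagram mu. q ^ U c)"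
      by (intro prod.cong) (auto simp: tableau_extension_def)
    also have "(\<Prod>c\<in>diagram lam - diagram mu. q ^ tableau_extension N lam mu U c)
      = (\<Prod>c\<in>diagram lam - diagram mu. q ^ N)"
      by (intro prod.cong) (auto simp: tableau_extension_def)
    also have "\<dots> = q ^ (N * ((\<Sum>i<Suc N. lam i) - (\<Sum>i<N. mu i)))"
      using card_Diff_subset [OF finite_subset [OF sub fin] sub]
        card_diagram [OF zero_lam] card_diagram [OF zero_mu [OF mu]]
      by (simp add: power_mult)
    finally show ?thesis .
  qed
  have "tableau_sum q (Suc N) lam
    = (\<Sum>(mu, U)\<in>?S. \<Prod>c\<in>diagram lam. q ^ tableau_extension N lam mu U c)"
    unfolding tableau_sum_def
  proof (rule sum.reindex_bij_witness
      [of _ "\<lambda>(mu, U). tableau_extension N lam mu U"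
        "\<lambda>T. (tableau_subshape N lam T, restrict T (diagram (tableau_subshape N lam T)))"], goal_cases)
    case (1 T)
    then show ?case by (simp add: tableau_extension_restrict)
  next
    case (2 T)
    then show ?case by (simp add: tableau_subshape_interlacing restrict_bounded_ssyt lam)
  next
    case (3 x)
    then show ?case by (auto simp: tableau_subshape_extension restrict_tableau_extension)
  next
    case (4 x)
    then show ?case by (auto intro!: tableau_extension_bounded_ssyt lam)
  next
    case (5 T)
    then show ?case by (simp add: tableau_extension_restrict)
  qed
  also have "\<dots> = (\<Sum>mu\<in>interlacing N lam. \<Sum>U\<in>bounded_ssyt N mu.
      \<Prod>c\<in>diagram lam. q ^ tableau_extension N lam mu U c)"
    using zero_mu by (subst sum.Sigma)
      (auto intro: finite_interlacing finite_bounded_ssyt finite_diagram)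
  also have "\<dots> = (\<Sum>mu\<in>interlacing N lam.
    tableau_sum q N mu * q ^ (N * ((\<Sum>i<Suc N. lam i) - (\<Sum>i<N. mu i))))"
    by (simp add: weight tableau_sum_def sum_distrib_right)
  finally show ?thesis .
qed

section \<open>Convergence of the sum over tableaux\<close>

lemma summable_ssyt:
  fixes x :: "nat \<Rightarrow> complex"
  assumes x: "summable (\<lambda>n. norm (x n))" and fin: "finite (diagram lam)"
  shows "(\<lambda>T. \<Prod>c\<in>diagram lam. x (T c)) summable_on ssyt lam"
proof -
  \<comment> \<open>Over all fillings the sum factors into one absolutely convergent series per
    box.\<close>
  have "Infinite_Set_Sum.abs_summable_on (\<lambda>T. \<Prod>c\<in>diagram lam. x (T c)) (diagram lam \<rightarrow>\<^sub>E UNIV)"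
    using assms by (intro abs_summable_on_prod_PiE) (auto simp: abs_summable_on_nat_iff')
  then have "(\<lambda>T. \<Prod>c\<in>diagram lam. x (T c)) summable_on (diagram lam \<rightarrow>\<^sub>E UNIV)"
    by (simp flip: abs_summable_equivalent add: abs_summable_summable)
  then show ?thesis
    by (rule summable_on_subset_banach) (auto simp: ssyt_def)
qed

text \<open>The tableaux with entries below \<open>N\<close> form finite sets that eventually
  contain any given finite set of tableaux, so the unordered sum is the limit along them. Since
  \<open>r ^ (2 * n + 1) = r * q ^ n\<close>, each box yields one factor \<open>r\<close>.\<close>

lemma schur_rho_limit:
  assumes q: "norm q < 1" "r\<^sup>2 = q" and zero: "\<forall>i\<ge>M. lam i = 0"
  shows "(\<lambda>N. r ^ (\<Sum>i<M. lam i) * tableau_sum q N lam) \<longlonglongrightarrow> schur_rho r lam"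
proof -
  let ?x = "\<lambda>n. r ^ (2 * n + 1)"
  let ?f = "\<lambda>T. \<Prod>c\<in>diagram lam. ?x (T c)"
  note fin = finite_diagram [OF zero]
  have "?f summable_on ssyt lam"
  proof (rule summable_ssyt [OF _ fin])
    have "norm (r ^ (2 * n + 1)) = norm r * norm q ^ n" for n
      by (simp add: q(2) [symmetric] norm_mult norm_power power_mult)
    then show "summable (\<lambda>n. norm (r ^ (2 * n + 1)))"
      using q(1) by (simp only:) (intro summable_mult summable_geometric, simp)
  qed
  then have "(?f has_sum schur_rho r lam) (ssyt lam)"
    by (simp add: schur_rho_def schur_def has_sum_infsum)
  moreover have "filterlim (\<lambda>N. bounded_ssyt N lam) (finite_subsets_at_top (ssyt lam)) sequentially"
    unfolding filterlim_finite_subsets_at_top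
  proof safe
    fix X assume X: "finite X" "X \<subseteq> ssyt lam"
    let ?E = "\<Union>T\<in>X. T ` diagram lam"
    have "T c < N" if "N > Max ?E" "T \<in> X" "c \<in> diagram lam" for N T c
    proof -
      have "T c \<le> Max ?E" using X(1) fin that by (intro Max_ge) auto
      then show ?thesis using that(1) by simp
    qed
    then have "X \<subseteq> bounded_ssyt N lam" if "N > Max ?E" for N
      using X(2) that unfolding bounded_ssyt_def by blast
    then have "finite (bounded_ssyt N lam) \<and> X \<subseteq> bounded_ssyt N lam \<and> bounded_ssyt N lam \<subseteq> ssyt lam"
      if "N > Max ?E" for N
      using that finite_bounded_ssyt [OF fin] by (auto simp: bounded_ssyt_def)
    then show "\<forall>\<^sub>F N in sequentially. finite (bounded_ssyt N lam) \<and> X \<subseteq> bounded_ssyt N lam \<and>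
        bounded_ssyt N lam \<subseteq> ssyt lam"
      by (rule eventually_mono [OF eventually_gt_at_top])
  qed
  ultimately have "(\<lambda>N. sum ?f (bounded_ssyt N lam)) \<longlonglongrightarrow> schur_rho r lam"
    unfolding has_sum_def by (rule filterlim_compose)
  moreover have "sum ?f (bounded_ssyt N lam) = r ^ (\<Sum>i<M. lam i) * tableau_sum q N lam" for N
    by (simp add: tableau_sum_def sum_distrib_left q(2) [symmetric] power_mult prod.distrib
        card_diagram [OF zero])
  ultimately show ?thesis by simp
qed

section \<open>Principal specialization\<close>

lemma det_scale_rows_columns:
  fixes a :: "nat \<Rightarrow> nat \<Rightarrow> 'a::comm_ring_1"
  shows "det (mat n n (\<lambda>(i, j). u i * v j * a i j))
    = (\<Prod>i<n. u i) * (\<Prod>j<n. v j) * det (mat n n (\<lambda>(i, j). a i j))"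
proof -
  have "(\<Prod>i<n. u i * v (p i) * a i (p i)) = (\<Prod>i<n. u i) * (\<Prod>j<n. v j) * (\<Prod>i<n. a i (p i))"
    if "p permutes {0..<n}" for p
    using prod.permute [OF that, of v] by (simp add: atLeast0LessThan o_def prod.distrib)
  moreover have "det (mat n n (\<lambda>(i, j). u i * v j * a i j))
    = (\<Sum>p\<in>{p. p permutes {0..<n}}. signof p * (\<Prod>i<n. u i * v (p i) * a i (p i)))"
    by (subst det_def'[where n=n])
      (auto intro!: sum.cong prod.cong simp: atLeast0LessThan dest: permutes_in_image)
  ultimately have "det (mat n n (\<lambda>(i, j). u i * v j * a i j))
    = (\<Sum>p\<in>{p. p permutes {0..<n}}. signof p * ((\<Prod>i<n. u i) * (\<Prod>j<n. v j) * (\<Prod>i<n. a i (p i))))"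
    by simp
  also have "\<dots> = (\<Prod>i<n. u i) * (\<Prod>j<n. v j) * (\<Sum>p\<in>{p. p permutes {0..<n}}. signof p * (\<Prod>i<n. a i (p i)))"
    by (simp add: sum_distrib_left mult_ac)
  also have "\<dots> = (\<Prod>i<n. u i) * (\<Prod>j<n. v j) * det (mat n n (\<lambda>(i, j). a i j))"
    by (subst det_def'[where n=n])
      (auto intro!: arg_cong2[where f="(*)"] sum.cong prod.cong simp: atLeast0LessThan dest: permutes_in_image)
  finally show ?thesis .
qed

definition vandermonde :: "nat \<Rightarrow> (nat \<Rightarrow> 'a::comm_ring_1) \<Rightarrow> 'a" where
  "vandermonde n b = (\<Prod>j<n. \<Prod>i<j. b j - b i)"

text \<open>The exponent is \<open>i - lam i\<close>, strictly increasing along the rows of a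
  partition; the division avoids integer exponents.\<close>

definition node :: "complex \<Rightarrow> (nat \<Rightarrow> nat) \<Rightarrow> nat \<Rightarrow> complex" where
  "node q lam i = q ^ i / q ^ lam i"

text \<open>For \<open>b = lam i\<close> and \<open>a = lam (Suc i)\<close> the two ends are powers
  of the nodes of rows \<open>i\<close> and \<open>Suc i\<close>: stepping past the end of the range
  costs one factor q, exactly as raising the row index does.\<close>

lemma geometric_sum_nodes:
  fixes q :: complex
  assumes "q \<noteq> 0" "q ^ Suc j \<noteq> 1" "a \<le> b"
  shows "(\<Sum>s=a..b. (q ^ i / q ^ s) ^ Suc j)
    = ((q ^ i / q ^ b) ^ Suc j - (q ^ Suc i / q ^ a) ^ Suc j) / (1 - q ^ Suc j)"
  using assms(3)
proof (induction b rule: dec_induct)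
  case base
  show ?case using assms by (simp add: field_simps power_mult_distrib power_divide)
next
  case (step b)
  then have "(\<Sum>s=a..Suc b. (q ^ i / q ^ s) ^ Suc j)
    = ((q ^ i / q ^ b) ^ Suc j - (q ^ Suc i / q ^ a) ^ Suc j) / (1 - q ^ Suc j) + (q ^ i / q ^ Suc b) ^ Suc j"
    by (simp del: power_Suc)
  also have "(q ^ i / q ^ b) ^ Suc j = q ^ Suc j * (q ^ i / q ^ Suc b) ^ Suc j"
    using assms(1) by (simp add: power_mult_distrib [symmetric] del: power_Suc) (simp add: field_simps)
  finally show ?case using assms(2) by (simp add: divide_simps del: power_Suc) (simp add: algebra_simps del: power_Suc)
qed

text \<open>The parts of \<open>mu\<close> range independently, so the determinant is summed row by
  row. The product of the nodes raises all exponents by one; this keeps each ratio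
  \<open>q ^ Suc j\<close> different from 1 and produces the matrix of
  \<open>det_consecutive_differences\<close>, with \<open>1 / (1 - q ^ Suc j)\<close> pulled out of
  column \<open>j\<close>.\<close>

lemma interlacing_vandermonde_sum:
  assumes q: "q \<noteq> 0" "\<And>e. q ^ Suc e \<noteq> 1" and lam: "antimono lam"
  shows "(\<Sum>mu\<in>interlacing N lam. (\<Prod>i<N. node q mu i) * vandermonde N (node q mu))
    = (-1) ^ N / (\<Prod>e<N. 1 - q ^ Suc e) * vandermonde (Suc N) (node q lam)"
proof -
  let ?S = "\<lambda>i. {lam (Suc i)..lam i}"
  have "(\<Sum>mu\<in>interlacing N lam. (\<Prod>i<N. node q mu i) * vandermonde N (node q mu))
    = (\<Sum>m\<in>Pi\<^sub>E {..<N} ?S. (\<Prod>i<N. node q m i) * vandermonde N (node q m))"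
  proof (rule sum.reindex_bij_witness [of _ "\<lambda>m i. if i < N then m i else 0" "\<lambda>mu. restrict mu {..<N}"], goal_cases)
    case (1 mu)
    then show ?case by (auto simp: interlacing_def fun_eq_iff)
  next
    case (2 mu)
    then show ?case by (auto simp: interlacing_def)
  next
    case (3 m)
    then show ?case by (auto simp: fun_eq_iff PiE_iff extensional_def)
  next
    case (4 m)
    then show ?case by (auto simp: interlacing_def PiE_iff)
  next
    case (5 mu)
    have "node q (restrict mu {..<N}) i = node q mu i" if "i < N" for i
      using that by (simp add: node_def)
    then show ?case by (simp add: vandermonde_def)
  qed
  also have "\<dots> = (\<Sum>m\<in>Pi\<^sub>E {..<N} ?S. det (mat N N (\<lambda>(i, j). (q ^ i / q ^ m i) ^ Suc j)))"
  proof (rule sum.cong [OF refl])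
    fix m
    show "(\<Prod>i<N. node q m i) * vandermonde N (node q m)
        = det (mat N N (\<lambda>(i, j). (q ^ i / q ^ m i) ^ Suc j))"
      using det_scale_rows_columns [of N "node q m" "\<lambda>_. 1" "\<lambda>i j. node q m i ^ j"]
      by (simp add: det_vandermonde vandermonde_def node_def)
  qed
  also have "\<dots> = det (mat N N (\<lambda>(i, j). \<Sum>s\<in>?S i. (q ^ i / q ^ s) ^ Suc j))"
    by (rule det_sum_PiE) simp
  also have "mat N N (\<lambda>(i, j). \<Sum>s\<in>?S i. (q ^ i / q ^ s) ^ Suc j)
      = mat N N (\<lambda>(i, j). 1 * (1 / (1 - q ^ Suc j)) * (node q lam i ^ Suc j - node q lam (Suc i) ^ Suc j))"
  proof (intro cong_mat refl)
    fix i j assume "i < N" "j < N"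
    have "lam (Suc i) \<le> lam i" using lam by (simp add: antimonoD)
    from geometric_sum_nodes [OF q this, of i j]
    show "(case (i, j) of (i, j) \<Rightarrow> \<Sum>s\<in>?S i. (q ^ i / q ^ s) ^ Suc j) = (case (i, j) of (i, j) \<Rightarrow>
        1 * (1 / (1 - q ^ Suc j)) * (node q lam i ^ Suc j - node q lam (Suc i) ^ Suc j))"
      by (simp add: node_def del: power_Suc)
  qed
  also have "det \<dots> = (\<Prod>e<N. 1 / (1 - q ^ Suc e)) *
      ((-1) ^ N * det (mat (Suc N) (Suc N) (\<lambda>(i, j). node q lam i ^ j)))"
    unfolding det_scale_rows_columns det_consecutive_differences by simp
  also have "\<dots> = (-1) ^ N / (\<Prod>e<N. 1 - q ^ Suc e) * vandermonde (Suc N) (node q lam)"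
    unfolding det_vandermonde vandermonde_def by (simp add: prod_dividef del: power_Suc)
  finally show ?thesis .
qed

lemma prod_node: "(\<Prod>i<n. node q lam i) = (\<Prod>i<n. q ^ i) / q ^ (\<Sum>i<n. lam i)"
  by (simp add: node_def prod_dividef power_sum)

text \<open>Only ratios of tableau sums matter in the end, so the constant is left unspecified.\<close>

lemma tableau_sum_eq_vandermonde:
  assumes q: "q \<noteq> 0" "\<And>e. q ^ Suc e \<noteq> 1"
  shows "\<exists>K. \<forall>lam. antimono lam \<longrightarrow> (\<forall>i\<ge>N. lam i = 0) \<longrightarrow> tableau_sum q N lam
    = K * q ^ (N * (\<Sum>i<N. lam i)) * (\<Prod>i<N. node q lam i) * vandermonde N (node q lam)"
proof (induction N)
  case 0
  have "tableau_sum q 0 lam = 1" if "\<forall>i\<ge>0. lam i = 0" for lam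
  proof -
    have "lam = (\<lambda>_. 0)" using that by (simp add: fun_eq_iff)
    then show ?thesis by (simp add: tableau_sum_def bounded_ssyt_def ssyt_def diagram_def)
  qed
  then show ?case by (intro exI[of _ 1]) (simp add: vandermonde_def)
next
  case (Suc N)
  then obtain K where K: "\<And>mu. antimono mu \<Longrightarrow> \<forall>i\<ge>N. mu i = 0 \<Longrightarrow> tableau_sum q N mu
    = K * q ^ (N * (\<Sum>i<N. mu i)) * (\<Prod>i<N. node q mu i) * vandermonde N (node q mu)" by blast
  define C where "C = (-1) ^ N / (\<Prod>e<N. 1 - q ^ Suc e)"
  let ?P = "\<Prod>i<Suc N. q ^ i"
  have P: "?P \<noteq> 0" using q(1) by simp
  have "tableau_sum q (Suc N) lam = K * C / ?P * q ^ (Suc N * (\<Sum>i<Suc N. lam i))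
      * (\<Prod>i<Suc N. node q lam i) * vandermonde (Suc N) (node q lam)"
    if lam: "antimono lam" "\<forall>i\<ge>Suc N. lam i = 0" for lam
  proof -
    let ?l = "\<Sum>i<Suc N. lam i"
    \<comment> \<open>The branching weight completes the power of q in the induction hypothesis to
      \<open>q ^ (N * ?l)\<close>, which does not depend on \<open>mu\<close> and leaves the
      sum.\<close>
    have "tableau_sum q N mu * q ^ (N * (?l - (\<Sum>i<N. mu i)))
      = K * q ^ (N * ?l) * ((\<Prod>i<N. node q mu i) * vandermonde N (node q mu))"
      if mu: "mu \<in> interlacing N lam" for mu
    proof -
      have "(\<Sum>i<N. mu i) \<le> (\<Sum>i<N. lam i)"
        using mu by (intro sum_mono) (auto simp: interlacing_def)
      then have "(\<Sum>i<N. mu i) \<le> ?l" by simp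
      then have "(\<Sum>i<N. mu i) + (?l - (\<Sum>i<N. mu i)) = ?l" by (rule le_add_diff_inverse)
      then have "q ^ (N * ?l) = q ^ (N * (\<Sum>i<N. mu i)) * q ^ (N * (?l - (\<Sum>i<N. mu i)))"
        by (simp only: power_add [symmetric] distrib_left [symmetric])
      moreover have "tableau_sum q N mu
        = K * q ^ (N * (\<Sum>i<N. mu i)) * (\<Prod>i<N. node q mu i) * vandermonde N (node q mu)"
        using mu by (intro K interlacing_antimono [OF lam(1)]) (auto simp: interlacing_def)
      ultimately show ?thesis by (simp only: mult_ac)
    qed
    then have summand: "(\<Sum>mu\<in>interlacing N lam. tableau_sum q N mu * q ^ (N * (?l - (\<Sum>i<N. mu i))))
      = (\<Sum>mu\<in>interlacing N lam. K * q ^ (N * ?l) * ((\<Prod>i<N. node q mu i) * vandermonde N (node q mu)))"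
      by (rule sum.cong [OF refl])
    have "\<forall>i>N. lam i = 0" using lam(2) by simp
    then have "tableau_sum q (Suc N) lam = (\<Sum>mu\<in>interlacing N lam. tableau_sum q N mu * q ^ (N * (?l - (\<Sum>i<N. mu i))))"
      by (rule tableau_sum_Suc [OF lam(1)])
    also have "\<dots> = K * q ^ (N * ?l) * (C * vandermonde (Suc N) (node q lam))"
      unfolding summand sum_distrib_left [symmetric] interlacing_vandermonde_sum [OF q lam(1)] C_def ..
    \<comment> \<open>By \<open>prod_node\<close> the product of all nodes is
      \<open>?P / q ^ ?l\<close>, so it pays for the additional \<open>q ^ ?l\<close> in the formula
      for \<open>Suc N\<close>.\<close>
    also have "q ^ (N * ?l) = q ^ (Suc N * ?l) * (\<Prod>i<Suc N. node q lam i) / ?P"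
    proof -
      have "x = y * x * (p / y) / p" if "p \<noteq> 0" "y \<noteq> 0" for x y p :: complex
        using that by simp
      from this [OF P, of "q ^ ?l"] show ?thesis
        unfolding prod_node mult_Suc power_add using q(1) by simp
    qed
    finally show ?thesis by (simp only: mult_ac times_divide_eq_right times_divide_eq_left)
  qed
  then show ?case by blast
qed

text \<open>Only differences with node \<open>k\<close> change, and their signs agree on both sides.
  The form without division also covers coinciding nodes.\<close>

lemma vandermonde_fun_upd:
  fixes b :: "nat \<Rightarrow> 'a::idom"
  assumes "k < n"
  shows "vandermonde n (b(k := t)) * (\<Prod>j\<in>{..<n} - {k}. b k - b j)
    = vandermonde n b * (\<Prod>j\<in>{..<n} - {k}. t - b j)"
  using assms
proof (induction n)
  case (Suc n)
  show ?case
  proof (cases "k = n")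
    case True
    have "{..<Suc n} - {n} = {..<n}" by auto
    then show ?thesis using True by (simp add: vandermonde_def mult_ac)
  next
    case False
    with Suc.prems have k: "k < n" by simp
    have split: "(\<Prod>j\<in>{..<Suc n} - {k}. g j) = (\<Prod>j\<in>{..<n} - {k}. g j) * g n" for g :: "nat \<Rightarrow> 'a"
    proof -
      have "{..<Suc n} - {k} = insert n ({..<n} - {k})" using k by auto
      then show ?thesis by (simp add: mult.commute)
    qed
    have last: "(\<Prod>i<n. b n - (b(k := s)) i) = (b n - s) * (\<Prod>i\<in>{..<n} - {k}. b n - b i)" for s
    proof -
      have "(\<Prod>i<n. b n - (b(k := s)) i)
        = (b n - (b(k := s)) k) * (\<Prod>i\<in>{..<n} - {k}. b n - (b(k := s)) i)"
        using k by (intro prod.remove) auto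
      also have "(\<Prod>i\<in>{..<n} - {k}. b n - (b(k := s)) i) = (\<Prod>i\<in>{..<n} - {k}. b n - b i)"
        by (intro prod.cong) auto
      finally show ?thesis by simp
    qed
    define R where "R = (\<Prod>i\<in>{..<n} - {k}. b n - b i)"
    have V: "vandermonde (Suc n) (b(k := s)) = vandermonde n (b(k := s)) * ((b n - s) * R)" for s
      using last [of s] k by (simp add: vandermonde_def R_def)
    have V': "vandermonde (Suc n) b = vandermonde n b * ((b n - b k) * R)"
      using V [of "b k"] by simp
    let ?c = "(b n - t) * (b k - b n) * R"
    have "vandermonde (Suc n) (b(k := t)) * (\<Prod>j\<in>{..<Suc n} - {k}. b k - b j)
        = vandermonde n (b(k := t)) * (\<Prod>j\<in>{..<n} - {k}. b k - b j) * ?c"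
      unfolding V split by (simp only: mult_ac)
    also have "\<dots> = vandermonde n b * (\<Prod>j\<in>{..<n} - {k}. t - b j) * ?c"
      by (simp only: Suc.IH [OF k])
    also have "?c = (b n - b k) * (t - b n) * R"
      by (simp add: algebra_simps)
    also have "vandermonde n b * (\<Prod>j\<in>{..<n} - {k}. t - b j) * \<dots>
        = vandermonde (Suc n) b * (\<Prod>j\<in>{..<Suc n} - {k}. t - b j)"
      unfolding V' split by (simp only: mult_ac)
    finally show ?thesis .
  qed
qed simp

text \<open>The added box divides node \<open>k\<close> by q, and the constant \<open>K\<close> is
  common to both shapes. The powers of q balance: the weight factor gains \<open>q ^ N\<close>, the
  product of nodes loses one q, and the denominators of the \<open>N - 1\<close> changed differences
  take the rest.\<close>

lemma tableau_sum_add_box: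
  assumes q: "q \<noteq> 0" "\<And>e. q ^ Suc e \<noteq> 1"
    and mu: "antimono mu" "\<forall>i\<ge>N. mu i = 0" and k: "k < N"
    and lam: "lam = mu(k := Suc (mu k))" "antimono lam"
  shows "tableau_sum q N lam * (\<Prod>j\<in>{..<N} - {k}. node q mu k - node q mu j)
    = tableau_sum q N mu * (\<Prod>j\<in>{..<N} - {k}. node q mu k - q * node q mu j)"
proof -
  obtain K where K: "\<And>mu. antimono mu \<Longrightarrow> \<forall>i\<ge>N. mu i = 0 \<Longrightarrow> tableau_sum q N mu
    = K * q ^ (N * (\<Sum>i<N. mu i)) * (\<Prod>i<N. node q mu i) * vandermonde N (node q mu)"
    using tableau_sum_eq_vandermonde [OF q] by blast
  let ?b = "node q mu" and ?J = "{..<N} - {k}"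
  have node_lam: "node q lam = ?b(k := ?b k / q)"
    using lam(1) by (auto simp: node_def fun_eq_iff)
  have zero: "\<forall>i\<ge>N. lam i = 0" using lam(1) mu(2) k by auto
  have sums: "(\<Sum>i<N. lam i) = Suc (\<Sum>i<N. mu i)"
    using k by (simp add: lam(1) sum.remove [of "{..<N}" k])
  have V: "vandermonde N (node q lam) * (\<Prod>j\<in>?J. ?b k - ?b j)
      = vandermonde N ?b * (\<Prod>j\<in>?J. ?b k / q - ?b j)"
    unfolding node_lam by (rule vandermonde_fun_upd [OF k])
  have "(\<Prod>j\<in>?J. ?b k / q - ?b j) = (\<Prod>j\<in>?J. (?b k - q * ?b j) / q)"
    using q(1) by (intro prod.cong) (auto simp: field_simps)
  also have "\<dots> = (\<Prod>j\<in>?J. ?b k - q * ?b j) / q ^ (N - 1)"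
    using k by (simp add: prod_dividef)
  finally have W: "(\<Prod>j\<in>?J. ?b k / q - ?b j) = (\<Prod>j\<in>?J. ?b k - q * ?b j) / q ^ (N - 1)" .
  have prods: "q ^ (N * (\<Sum>i<N. lam i)) * (\<Prod>i<N. node q lam i)
    = q ^ (N - 1) * (q ^ (N * (\<Sum>i<N. mu i)) * (\<Prod>i<N. ?b i))"
  proof -
    have "N * Suc (\<Sum>i<N. mu i) = Suc (N - 1) + N * (\<Sum>i<N. mu i)" using k by simp
    then have "q ^ (N * (\<Sum>i<N. lam i)) = q * q ^ (N - 1) * q ^ (N * (\<Sum>i<N. mu i))"
      unfolding sums by (simp only: power_add power_Suc)
    moreover have "(\<Prod>i<N. node q lam i) = (\<Prod>i<N. ?b i) / q"
      unfolding prod_node sums by (simp add: mult.commute)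
    ultimately show ?thesis using q(1) by simp
  qed
  have "tableau_sum q N lam * (\<Prod>j\<in>?J. ?b k - ?b j)
    = K * (q ^ (N * (\<Sum>i<N. lam i)) * (\<Prod>i<N. node q lam i))
      * (vandermonde N (node q lam) * (\<Prod>j\<in>?J. ?b k - ?b j))"
    unfolding K [OF lam(2) zero] by (simp only: mult.assoc)
  also have "\<dots> = K * (q ^ (N * (\<Sum>i<N. mu i)) * (\<Prod>i<N. ?b i)) * vandermonde N ?b
      * (\<Prod>j\<in>?J. ?b k - q * ?b j)"
    unfolding prods V W using q(1) by simp
  also have "\<dots> = tableau_sum q N mu * (\<Prod>j\<in>?J. ?b k - q * ?b j)"
    unfolding K [OF mu] by (simp only: mult.assoc)
  finally show ?thesis .
qed

section \<open>Adding a box in infinitely many variables\<close>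

lemma power_inject_norm_less_1:
  fixes q :: complex
  assumes "0 < norm q" "norm q < 1" "q ^ a = q ^ b"
  shows "a = b"
proof -
  have "norm q ^ a = norm q ^ b" using assms(3) by (metis norm_power)
  then show ?thesis using assms(1,2) power_strict_decreasing [of _ _ "norm q"]
    by (metis less_irrefl nat_neq_iff)
qed

lemma prod_telescope_shift:
  fixes x q :: "'a::comm_ring_1"
  assumes "M \<le> N"
  shows "(\<Prod>j\<in>{M..<N}. x - q * q ^ j) * (x - q ^ M) = (\<Prod>j\<in>{M..<N}. x - q ^ j) * (x - q ^ N)"
  using assms
proof (induction N rule: dec_induct)
  case (step N)
  have "(\<Prod>j\<in>{M..<Suc N}. x - q * q ^ j) * (x - q ^ M)
    = (\<Prod>j\<in>{M..<N}. x - q * q ^ j) * (x - q ^ M) * (x - q * q ^ N)"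
    using step.hyps(1) by (simp add: mult_ac)
  also have "\<dots> = (\<Prod>j\<in>{M..<N}. x - q ^ j) * (x - q ^ N) * (x - q * q ^ N)"
    by (simp only: step.IH)
  finally show ?case using step.hyps(1) by (simp add: mult_ac)
qed simp

text \<open>
  In the limit of infinitely many variables the factors of the empty rows telescope, which is
  why only finitely many rows remain.
\<close>

lemma schur_rho_add_box:
  assumes q: "0 < norm q" "norm q < 1" "r\<^sup>2 = q"
    and mu: "antimono mu" "\<forall>i\<ge>M. mu i = 0" and k: "k < M"
    and lam: "lam = mu(k := Suc (mu k))" "antimono lam"
  shows "schur_rho r lam * (node q mu k - q ^ M) * (\<Prod>j\<in>{..<M} - {k}. node q mu k - node q mu j)
    = r * schur_rho r mu * node q mu k * (\<Prod>j\<in>{..<M} - {k}. node q mu k - q * node q mu j)"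
proof -
  let ?x = "node q mu k"
  define A where "A = (\<Prod>j\<in>{..<M} - {k}. ?x - node q mu j)"
  define B where "B = (\<Prod>j\<in>{..<M} - {k}. ?x - q * node q mu j)"
  have q0: "q \<noteq> 0" using q(1) by auto
  have q1: "q ^ Suc e \<noteq> 1" for e
    using power_inject_norm_less_1 [OF q(1,2), of "Suc e" 0] by auto
  \<comment> \<open>The exponent \<open>k - mu k\<close> of this node is at most \<open>k\<close>,
    hence below \<open>M\<close>.\<close>
  have x_ne: "?x \<noteq> q ^ j" if "j \<ge> M" for j
  proof
    assume "?x = q ^ j"
    then have "q ^ k = q ^ (j + mu k)" using q0 by (simp add: node_def power_add nonzero_divide_eq_eq)
    then have "k = j + mu k" by (rule power_inject_norm_less_1 [OF q(1,2)])
    then show False using k that by simp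
  qed
  \<comment> \<open>The products over rows \<open>M\<close> to \<open>N - 1\<close> cancel except
    for the two boundary factors.\<close>
  have fin: "tableau_sum q N lam * A * (?x - q ^ M) = tableau_sum q N mu * B * (?x - q ^ N)"
    if N: "N \<ge> M" for N
  proof -
    have split: "(\<Prod>j\<in>{..<N} - {k}. g j) = (\<Prod>j\<in>{..<M} - {k}. g j) * (\<Prod>j\<in>{M..<N}. g j)"
      for g :: "nat \<Rightarrow> complex"
    proof -
      have "{..<N} - {k} = ({..<M} - {k}) \<union> {M..<N}" using N k by auto
      moreover have "({..<M} - {k}) \<inter> {M..<N} = {}" by auto
      ultimately show ?thesis by (simp add: prod.union_disjoint)
    qed
    have tail: "node q mu j = q ^ j" if "j \<in> {M..<N}" for j
      using that mu(2) by (simp add: node_def)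
    let ?C = "\<Prod>j\<in>{M..<N}. ?x - q ^ j" and ?D = "\<Prod>j\<in>{M..<N}. ?x - q * q ^ j"
    have C: "?C \<noteq> 0" using x_ne by simp
    have "tableau_sum q N lam * (A * ?C) = tableau_sum q N mu * (B * ?D)"
      using tableau_sum_add_box [OF q0 q1 mu(1) _ _ lam, of N] mu(2) k N
      by (simp add: split tail A_def B_def)
    then have "tableau_sum q N lam * A * (?x - q ^ M) * ?C = tableau_sum q N mu * B * (?D * (?x - q ^ M))"
      by (simp add: mult_ac)
    also have "\<dots> = tableau_sum q N mu * B * (?x - q ^ N) * ?C"
      unfolding prod_telescope_shift [OF N] by (simp only: mult_ac)
    finally show ?thesis using C by simp
  qed
  have "\<forall>i\<ge>M. lam i = 0" using lam(1) mu(2) k by auto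
  from schur_rho_limit [OF q(2,3) this]
  have lim_lam: "(\<lambda>N. r ^ (\<Sum>i<M. lam i) * tableau_sum q N lam * (A * (?x - q ^ M)))
      \<longlonglongrightarrow> schur_rho r lam * (A * (?x - q ^ M))"
    by (rule tendsto_mult_right)
  \<comment> \<open>The boundary factor at \<open>N\<close> tends to \<open>?x\<close> because
    \<open>q ^ N\<close> tends to 0; the separate \<open>r\<close> belongs to the added box.\<close>
  have lim_mu: "(\<lambda>N. r * (r ^ (\<Sum>i<M. mu i) * tableau_sum q N mu * B * (?x - q ^ N)))
      \<longlonglongrightarrow> r * (schur_rho r mu * B * (?x - 0))"
    using q by (intro tendsto_intros schur_rho_limit [OF q(2,3) mu(2)] LIMSEQ_power_zero)
  have ev: "\<forall>\<^sub>F N in sequentially. r ^ (\<Sum>i<M. lam i) * tableau_sum q N lam * (A * (?x - q ^ M))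
      = r * (r ^ (\<Sum>i<M. mu i) * tableau_sum q N mu * B * (?x - q ^ N))"
  proof (rule eventually_mono [OF eventually_ge_at_top [of M]])
    fix N assume "M \<le> N"
    have "(\<Sum>i<M. lam i) = Suc (\<Sum>i<M. mu i)"
      using k by (simp add: lam(1) sum.remove [of "{..<M}" k])
    then have "r ^ (\<Sum>i<M. lam i) * tableau_sum q N lam * (A * (?x - q ^ M))
        = r * r ^ (\<Sum>i<M. mu i) * (tableau_sum q N lam * A * (?x - q ^ M))"
      by (simp add: mult_ac)
    also have "\<dots> = r * (r ^ (\<Sum>i<M. mu i) * tableau_sum q N mu * B * (?x - q ^ N))"
      unfolding fin [OF \<open>M \<le> N\<close>] by (simp only: mult_ac)
    finally show "r ^ (\<Sum>i<M. lam i) * tableau_sum q N lam * (A * (?x - q ^ M))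
      = r * (r ^ (\<Sum>i<M. mu i) * tableau_sum q N mu * B * (?x - q ^ N))" .
  qed
  have "schur_rho r lam * (A * (?x - q ^ M)) = r * (schur_rho r mu * B * (?x - 0))"
    using LIMSEQ_unique [OF lim_lam] lim_mu tendsto_cong [OF ev] by blast
  then show ?thesis by (simp add: A_def B_def mult_ac)
qed

section \<open>Partial fractions\<close>

lemma degree_coeff_prod_linear:
  fixes a :: "'b \<Rightarrow> 'a::idom"
  assumes "finite I"
  shows "degree (\<Prod>i\<in>I. [:1, - a i:]) \<le> card I \<and> Polynomial.coeff (\<Prod>i\<in>I. [:1, - a i:]) (card I) = (\<Prod>i\<in>I. - a i)"
  using assms
proof (induction I)
  case (insert i I)
  let ?p = "\<Prod>i\<in>I. [:1, - a i:]"
  have "degree (\<Prod>i\<in>insert i I. [:1, - a i:]) \<le> card (insert i I)"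
  proof -
    have "degree ([:1, - a i:] * ?p) \<le> degree [:1, - a i:] + degree ?p" by (rule degree_mult_le)
    also have "\<dots> \<le> Suc (card I)" using insert.IH by simp
    finally show ?thesis using insert.hyps by simp
  qed
  moreover have "Polynomial.coeff ?p (Suc (card I)) = 0" using insert.IH by (simp add: coeff_eq_0)
  ultimately show ?case using insert by simp
qed simp

lemma poly_prod_linear_inverse:
  fixes b :: "'b \<Rightarrow> complex"
  assumes "x \<noteq> 0"
  shows "poly (\<Prod>j\<in>J. [:1, - b j:]) (inverse x) = (\<Prod>j\<in>J. x - b j) / x ^ card J"
proof -
  have "poly (\<Prod>j\<in>J. [:1, - b j:]) (inverse x) = (\<Prod>j\<in>J. (x - b j) / x)"
    using assms by (simp add: poly_prod field_simps)
  then show ?thesis by (simp add: prod_dividef)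
qed

text \<open>Every other summand contains the factor of \<open>b i\<close>, which vanishes at the
  reciprocal of \<open>b i\<close>; this reads off a residue.\<close>

lemma poly_sum_punctured_prod:
  fixes b :: "'b \<Rightarrow> 'a::comm_ring_1"
  assumes "finite I" "i \<in> I" "x * b i = 1"
  shows "poly (\<Sum>k\<in>I. Polynomial.smult (c k) (\<Prod>j\<in>I - {k}. [:1, - b j:])) x
    = c i * poly (\<Prod>j\<in>I - {i}. [:1, - b j:]) x"
proof -
  have "poly (\<Sum>k\<in>I. Polynomial.smult (c k) (\<Prod>j\<in>I - {k}. [:1, - b j:])) x
    = (\<Sum>k\<in>I. c k * poly (\<Prod>j\<in>I - {k}. [:1, - b j:]) x)"
    by (simp add: poly_sum)
  also have "\<dots> = (\<Sum>k\<in>{i}. c k * poly (\<Prod>j\<in>I - {k}. [:1, - b j:]) x)"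
  proof (rule sum.mono_neutral_right)
    show "\<forall>k\<in>I - {i}. c k * poly (\<Prod>j\<in>I - {k}. [:1, - b j:]) x = 0"
    proof
      fix k assume k: "k \<in> I - {i}"
      then have "(\<Prod>j\<in>I - {k}. [:1, - b j:]) = [:1, - b i:] * (\<Prod>j\<in>I - {k} - {i}. [:1, - b j:])"
        using assms(1,2) by (intro prod.remove) auto
      moreover have "poly [:1, - b i:] x = 0" using assms(3) by simp
      ultimately show "c k * poly (\<Prod>j\<in>I - {k}. [:1, - b j:]) x = 0"
        by (simp only: poly_mult mult_zero_left mult_zero_right)
    qed
  qed (use assms in auto)
  finally show ?thesis by simp
qed

lemma degree_sum_punctured_prod:
  fixes b :: "'b \<Rightarrow> 'a::idom"
  assumes "finite I"
  shows "degree (\<Sum>k\<in>I. Polynomial.smult (c k) (\<Prod>j\<in>I - {k}. [:1, - b j:])) \<le> card I - 1"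
proof (rule degree_sum_le [OF assms])
  fix k assume "k \<in> I"
  then have "degree (\<Prod>j\<in>I - {k}. [:1, - b j:]) \<le> card I - 1"
    using degree_coeff_prod_linear [of "I - {k}" b] assms by simp
  then show "degree (Polynomial.smult (c k) (\<Prod>j\<in>I - {k}. [:1, - b j:])) \<le> card I - 1"
    using degree_smult_le [of "c k"] by (rule order_trans [rotated])
qed

section \<open>Partial fraction identities with denominators cleared\<close>

abbreviation lin :: "complex \<Rightarrow> complex fps" where
  "lin a \<equiv> 1 - fps_const a * fps_X"

lemma fps_of_poly_linear: "fps_of_poly [:1, - a:] = lin a"
  by (simp add: fps_of_poly_pCons algebra_simps)

lemma fps_of_poly_shift: "fps_of_poly (pCons 0 p) = fps_X * fps_of_poly (p :: complex poly)"
  by (simp add: fps_of_poly_pCons mult.commute)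

text \<open>Multiplied by the denominators \<open>lin (a i)\<close>, the expansion is an identity of
  polynomials of degree at most \<open>Suc M\<close>. It is checked at 0, at the \<open>M\<close>
  reciprocals of the \<open>a i\<close>, where it is hypothesis \<open>c\<close>, and in the top
  coefficient, where it is \<open>lead\<close>.\<close>

lemma partial_fractions_removable:
  fixes a c :: "nat \<Rightarrow> complex"
  assumes inj: "inj_on a {..<M}" and nz: "\<And>i. i < M \<Longrightarrow> a i \<noteq> 0"
    and lead: "q ^ Suc M * a M = s"
    and c: "\<And>i. i < M \<Longrightarrow> (\<Prod>j\<le>M. a i - q * a j) = - c i * a i * (\<Prod>j\<in>{..<M} - {i}. a i - a j)"
  shows "(\<Prod>i\<le>M. lin (q * a i)) = lin s * (\<Prod>i<M. lin (a i))
    - fps_X * (\<Sum>i<M. fps_const (c i) * (\<Prod>j\<in>{..<M} - {i}. lin (a j)))"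
proof -
  let ?S = "\<Sum>i<M. Polynomial.smult (c i) (\<Prod>j\<in>{..<M} - {i}. [:1, - a j:])"
  let ?P = "\<Prod>i\<le>M. [:1, - (q * a i):]" and ?R = "\<Prod>i<M. [:1, - a i:]"
  let ?Q = "[:1, - s:] * ?R - pCons 0 ?S"
  have R: "degree ?R \<le> M" "Polynomial.coeff ?R M = (\<Prod>i<M. - a i)"
    using degree_coeff_prod_linear [of "{..<M}" a] by simp_all
  have P: "degree ?P \<le> Suc M" "Polynomial.coeff ?P (Suc M) = (\<Prod>i\<le>M. - (q * a i))"
    using degree_coeff_prod_linear [of "{..M}" "\<lambda>i. q * a i"] by simp_all
  have S: "degree ?S \<le> M - 1"
    using degree_sum_punctured_prod [of "{..<M}" c a] by simp
  have "?P = ?Q"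
  proof (rule poly_eqI_degree_lead_coeff [where n = "Suc M" and A = "insert 0 ((\<lambda>i. inverse (a i)) ` {..<M})"])
    have "(\<Prod>i\<le>M. - (q * a i)) = (\<Prod>i\<le>M. q * - a i)"
      by (simp only: mult_minus_right)
    also have "\<dots> = q ^ Suc M * (\<Prod>i\<le>M. - a i)"
      unfolding prod.distrib by simp
    also have "(\<Prod>i\<le>M. - a i) = (\<Prod>i<M. - a i) * - a M"
      unfolding lessThan_Suc_atMost [symmetric] prod.lessThan_Suc ..
    also have "q ^ Suc M * \<dots> = - s * (\<Prod>i<M. - a i)"
      unfolding lead [symmetric] by (simp only: mult_minus_left mult_minus_right mult_ac)
    finally have "Polynomial.coeff ?P (Suc M) = - s * Polynomial.coeff ?R M" unfolding P R .
    \<comment> \<open>For \<open>M = 0\<close> the bound \<open>M - 1\<close> is truncated, but then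
      the sum is empty.\<close>
    moreover have "Polynomial.coeff ?S M = 0"
    proof (cases "M = 0")
      case False
      then show ?thesis using S by (intro coeff_eq_0) simp
    qed simp
    moreover have "Polynomial.coeff ?R (Suc M) = 0" using R(1) by (intro coeff_eq_0) simp
    moreover have "Polynomial.coeff ([:1, - s:] * p - pCons 0 t) (Suc n) = Polynomial.coeff p (Suc n) - s * Polynomial.coeff p n - Polynomial.coeff t n"
      for p t n by simp
    ultimately show "Polynomial.coeff ?P (Suc M) = Polynomial.coeff ?Q (Suc M)"
      by (simp only: diff_0_right diff_0 mult_minus_left)
    have "inj_on (\<lambda>i. inverse (a i)) {..<M}"
      using inj by (auto simp: inj_on_def)
    moreover have "0 \<notin> (\<lambda>i. inverse (a i)) ` {..<M}" using nz by auto
    ultimately show "Suc M \<le> card (insert 0 ((\<lambda>i. inverse (a i)) ` {..<M}))"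
      by (simp add: card_image)
    show "degree ?P \<le> Suc M" by (rule P)
    have "degree [:1, - s:] \<le> 1" by simp
    then have "degree ([:1, - s:] * ?R) \<le> Suc M"
      using degree_mult_le [of "[:1, - s:]" ?R] R(1) by linarith
    moreover have "degree (pCons 0 ?S) \<le> Suc M"
      using degree_pCons_le [of 0 ?S] S by linarith
    ultimately show "degree ?Q \<le> Suc M" by (rule degree_diff_le)
    fix z assume "z \<in> insert 0 ((\<lambda>i. inverse (a i)) ` {..<M})"
    then consider "z = 0" | i where "i < M" "z = inverse (a i)" by auto
    then show "poly ?P z = poly ?Q z"
    proof cases
      case 1
      then show ?thesis by (simp add: poly_prod)
    next
      case (2 i)
      have "poly ?R z = 0"
        using 2 nz by (auto simp: poly_prod intro!: bexI[of _ i])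
      moreover have "poly ?S z = c i * poly (\<Prod>j\<in>{..<M} - {i}. [:1, - a j:]) z"
        using 2 nz by (intro poly_sum_punctured_prod) auto
      moreover have "poly ?P z = (\<Prod>j\<le>M. a i - q * a j) / a i ^ Suc M"
        unfolding 2 using poly_prod_linear_inverse [OF nz [OF 2(1)], of "\<lambda>j. q * a j" "{..M}"] by simp
      moreover have "poly (\<Prod>j\<in>{..<M} - {i}. [:1, - a j:]) z = (\<Prod>j\<in>{..<M} - {i}. a i - a j) / a i ^ (M - 1)"
        unfolding 2 using poly_prod_linear_inverse [OF nz [OF 2(1)], of a "{..<M} - {i}"] 2 by simp
      moreover have "poly ([:1, - s:] * p - pCons 0 t) z = poly [:1, - s:] z * poly p z - z * poly t z" for p t
        by (simp add: algebra_simps)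
      ultimately have eval: "poly ?P z = (\<Prod>j\<le>M. a i - q * a j) / a i ^ Suc M"
        "poly ?Q z = - (z * (c i * ((\<Prod>j\<in>{..<M} - {i}. a i - a j) / a i ^ (M - 1))))"
        by (simp_all only: mult_zero_right diff_0)
      have "a i ^ Suc M = a i ^ (M - 1) * (a i * a i)"
        using 2 by (cases M) (auto simp: mult_ac)
      then show ?thesis
        unfolding eval c [OF 2(1)] using 2(2) nz [OF 2(1)] by (simp add: divide_simps del: power_Suc)
    qed
  qed
  then have "fps_of_poly ?P = fps_of_poly ?Q" by simp
  then show ?thesis
    by (simp only: fps_of_poly_prod fps_of_poly_mult fps_of_poly_diff fps_of_poly_sum fps_of_poly_smult
        fps_of_poly_linear fps_of_poly_shift)
qed

text \<open>The right-hand side has degree at most \<open>m\<close>, the first summand on the left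
  possibly \<open>Suc m\<close>; by \<open>lead\<close> the multiple \<open>s\<close> of the common
  denominator cancels that top coefficient. The other checks are at the \<open>Suc m\<close>
  reciprocals of the \<open>a i\<close>, where the common denominator vanishes.\<close>

lemma partial_fractions_addable:
  fixes a d :: "nat \<Rightarrow> complex"
  assumes inj: "inj_on a {..m}" and nz: "\<And>i. i \<le> m \<Longrightarrow> a i \<noteq> 0"
    and lead: "s * a m * q ^ m = 1"
    and d: "\<And>i. i \<le> m \<Longrightarrow> (\<Prod>j<m. a i - a j / q) = d i * a i * (\<Prod>j\<in>{..m} - {i}. a i - a j)"
  shows "fps_X * (\<Prod>i<m. lin (a i / q)) + fps_const s * (\<Prod>i\<le>m. lin (a i))
    = (\<Sum>i\<le>m. fps_const (d i) * (\<Prod>j\<in>{..m} - {i}. lin (a j)))"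
proof -
  let ?S = "\<Sum>i\<le>m. Polynomial.smult (d i) (\<Prod>j\<in>{..m} - {i}. [:1, - a j:])"
  let ?P = "\<Prod>i<m. [:1, - (a i / q):]" and ?R = "\<Prod>i\<le>m. [:1, - a i:]"
  let ?Q = "pCons 0 ?P + Polynomial.smult s ?R"
  have R: "degree ?R \<le> Suc m" "Polynomial.coeff ?R (Suc m) = (\<Prod>i\<le>m. - a i)"
    using degree_coeff_prod_linear [of "{..m}" a] by simp_all
  have P: "degree ?P \<le> m" "Polynomial.coeff ?P m = (\<Prod>i<m. - (a i / q))"
    using degree_coeff_prod_linear [of "{..<m}" "\<lambda>i. a i / q"] by simp_all
  have S: "degree ?S \<le> m"
    using degree_sum_punctured_prod [of "{..m}" d a] by simp
  have "?Q = ?S"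
  proof (rule poly_eqI_degree_lead_coeff [where n = "Suc m" and A = "(\<lambda>i. inverse (a i)) ` {..m}"])
    have "(\<Prod>i<m. - (a i / q)) = (\<Prod>i<m. (- a i) / q)" by simp
    also have "\<dots> = (\<Prod>i<m. - a i) / q ^ m"
      by (simp only: prod_dividef prod_constant card_lessThan)
    also have "\<dots> = (\<Prod>i<m. - a i) * (s * a m)"
    proof -
      have "q ^ m \<noteq> 0" using lead by (metis mult_zero_right zero_neq_one)
      then show ?thesis using lead by (simp add: field_simps)
    qed
    finally have "Polynomial.coeff ?P m + s * Polynomial.coeff ?R (Suc m) = 0"
      unfolding P R by (simp add: lessThan_Suc_atMost [symmetric])
    moreover have "Polynomial.coeff ?S (Suc m) = 0" using S by (intro coeff_eq_0) simp
    ultimately show "Polynomial.coeff ?Q (Suc m) = Polynomial.coeff ?S (Suc m)" by simp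
    have "inj_on (\<lambda>i. inverse (a i)) {..m}"
      using inj by (auto simp: inj_on_def)
    then show "Suc m \<le> card ((\<lambda>i. inverse (a i)) ` {..m})"
      by (simp add: card_image)
    have "degree (pCons 0 ?P) \<le> Suc m" using degree_pCons_le [of 0 ?P] P(1) by linarith
    moreover have "degree (Polynomial.smult s ?R) \<le> Suc m" using degree_smult_le [of s ?R] R(1) by linarith
    ultimately show "degree ?Q \<le> Suc m" by (rule degree_add_le)
    show "degree ?S \<le> Suc m" using S by simp
    fix z assume "z \<in> (\<lambda>i. inverse (a i)) ` {..m}"
    then obtain i where i: "i \<le> m" "z = inverse (a i)" by auto
    note nzi = nz [OF i(1)]
    have "poly ?R z = 0"
      using i nz by (auto simp: poly_prod intro!: bexI[of _ i])
    moreover have "poly ?S z = d i * poly (\<Prod>j\<in>{..m} - {i}. [:1, - a j:]) z"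
      using i nz by (intro poly_sum_punctured_prod) auto
    moreover have "poly (\<Prod>j\<in>{..m} - {i}. [:1, - a j:]) z = (\<Prod>j\<in>{..m} - {i}. a i - a j) / a i ^ m"
      using poly_prod_linear_inverse [OF nzi, of a "{..m} - {i}"] i by simp
    moreover have "poly ?P z = (\<Prod>j<m. a i - a j / q) / a i ^ m"
      using poly_prod_linear_inverse [OF nzi, of "\<lambda>j. a j / q" "{..<m}"] i(2) by simp
    moreover have "poly ?Q z = z * poly ?P z + s * poly ?R z"
      by (simp only: poly_add poly_pCons poly_smult add_0_left)
    ultimately have "poly ?Q z = z * ((\<Prod>j<m. a i - a j / q) / a i ^ m)"
      "poly ?S z = d i * ((\<Prod>j\<in>{..m} - {i}. a i - a j) / a i ^ m)"
      by (simp_all only: mult_zero_right add_0_right)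
    then show "poly ?Q z = poly ?S z"
      unfolding d [OF i(1)] i(2) using nzi by simp
  qed
  then have "fps_of_poly ?Q = fps_of_poly ?S" by simp
  then show ?thesis
    by (simp only: fps_of_poly_prod fps_of_poly_add fps_of_poly_sum fps_of_poly_smult
        fps_of_poly_linear fps_of_poly_shift)
qed

section \<open>The exponential of the potential\<close>

lemma fps_linear_ode_unique:
  fixes F G :: "'a::field_char_0 fps"
  assumes F: "fps_deriv F = F * H" and G: "fps_deriv G = G * H" and init: "fps_nth F 0 = fps_nth G 0"
  shows "F = G"
proof (rule fps_ext)
  fix n show "fps_nth F n = fps_nth G n"
  proof (induction n rule: less_induct)
    case (less n)
    show ?case
    proof (cases n)
      case (Suc k)
      have "fps_nth (fps_deriv F) k = fps_nth (fps_deriv G) k"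
        unfolding F G fps_mult_nth using less Suc by (intro sum.cong) auto
      then show ?thesis using Suc by (simp add: of_nat_neq_0 del: of_nat_Suc)
    qed (simp add: init)
  qed
qed

text \<open>Exponentials are recognized by their logarithmic derivative, which reduces additivity
  and exp(log(1 - ax)) = 1 - ax to differentiation.\<close>

lemma fps_exp_compose_unique:
  fixes F g :: "'a::field_char_0 fps"
  assumes "fps_deriv F = F * fps_deriv g" "fps_nth F 0 = 1" "fps_nth g 0 = 0"
  shows "fps_exp 1 oo g = F"
proof (rule fps_linear_ode_unique)
  show "fps_deriv (fps_exp 1 oo g) = (fps_exp 1 oo g) * fps_deriv g"
    using assms(3) by (simp add: fps_compose_deriv)
qed (use assms in simp_all)

lemma fps_exp_compose_add:
  fixes f g :: "'a::field_char_0 fps"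
  assumes "fps_nth f 0 = 0" "fps_nth g 0 = 0"
  shows "fps_exp 1 oo (f + g) = (fps_exp 1 oo f) * (fps_exp 1 oo g)"
  using assms by (intro fps_exp_compose_unique) (simp_all add: fps_compose_deriv algebra_simps)

lemma fps_exp_compose_sum:
  fixes f :: "'b \<Rightarrow> 'a::field_char_0 fps"
  assumes "\<And>i. i \<in> I \<Longrightarrow> fps_nth (f i) 0 = 0"
  shows "fps_exp 1 oo (\<Sum>i\<in>I. f i) = (\<Prod>i\<in>I. fps_exp 1 oo f i)"
  using assms
proof (induction I rule: infinite_finite_induct)
  case (insert i I)
  then show ?case by (simp add: fps_exp_compose_add fps_sum_nth)
qed simp_all

text \<open>The constant coefficient is \<open>0\<close>, since \<open>1 / 0 = 0\<close>.\<close>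

definition fps_log1m :: "complex \<Rightarrow> complex fps" where
  "fps_log1m a = Abs_fps (\<lambda>n. - (a ^ n / of_nat n))"

lemma fps_exp_log1m: "fps_exp 1 oo fps_log1m a = lin a"
proof (rule fps_exp_compose_unique)
  have D: "fps_nth (fps_deriv (fps_log1m a)) n = - (a ^ Suc n)" for n
    by (simp add: fps_log1m_def field_simps del: of_nat_Suc)
  show "fps_deriv (lin a) = lin a * fps_deriv (fps_log1m a)"
  proof (rule fps_ext)
    fix n show "fps_nth (fps_deriv (lin a)) n = fps_nth (lin a * fps_deriv (fps_log1m a)) n"
      by (cases n) (simp_all add: D left_diff_distrib mult.assoc del: fps_deriv_nth)
  qed
qed (simp_all add: fps_log1m_def)

lemma fps_exp_minus_log1m: "fps_exp 1 oo (- fps_log1m a) = inverse (lin a)"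
proof -
  have "(fps_exp 1 oo fps_log1m a) * (fps_exp 1 oo (- fps_log1m a)) = fps_exp 1 oo (fps_log1m a + - fps_log1m a)"
    by (subst fps_exp_compose_add) (simp_all add: fps_log1m_def)
  then have "lin a * (fps_exp 1 oo (- fps_log1m a)) = 1"
    by (simp add: fps_exp_log1m)
  then show ?thesis by (rule fps_inverse_unique [symmetric])
qed

text \<open>Evaluates the x-adic sum over \<open>k\<close> in \<open>Z_deformed\<close>, which
  starts at the first power of x.\<close>

lemma suminf_fps_monomials:
  fixes S :: "complex fps"
  assumes "fps_nth S 0 = 0"
  shows "(\<Sum>k. fps_const (fps_nth S (Suc k)) * fps_X ^ Suc k) = S"
proof -
  have "(\<Sum>i=0..n. fps_const (fps_nth S i) * fps_X ^ i)
    = (\<Sum>k<n. fps_const (fps_nth S (Suc k)) * fps_X ^ Suc k)" for n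
    using assms by (simp add: sum.atLeast0_atMost_Suc_shift atLeast0AtMost lessThan_Suc_atMost [symmetric]
        sum.lessThan_Suc_shift del: sum.lessThan_Suc power_Suc)
  then have "(\<lambda>k. fps_const (fps_nth S (Suc k)) * fps_X ^ Suc k) sums S"
    using fps_notation [of S] by (simp add: sums_def del: power_Suc)
  then show ?thesis by (rule sums_unique [symmetric])
qed

text \<open>With parts numbered from $1$ this is $q^{\lambda_i-i+1/2}$, the reciprocal of a zero of $F_\lambda$.\<close>

definition maya :: "complex \<Rightarrow> complex \<Rightarrow> (nat \<Rightarrow> nat) \<Rightarrow> nat \<Rightarrow> complex" where
  "maya q r lam i = q ^ lam i / (r * q ^ i)"

text \<open>\<open>phi\<close> is a difference of power sums over the rows, to which empty rows
  contribute nothing. With the couplings inserted each row gives log(1 - ax) for its own Maya value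
  minus the same for the empty partition.\<close>

lemma exp_potential:
  assumes q: "q \<noteq> 0" and zero: "\<forall>i\<ge>M. lam i = 0"
  shows "fps_exp 1 oo (\<Sum>k. - (fps_const (inverse r ^ Suc k / of_nat (Suc k)) * fps_X ^ Suc k) *
      fps_const (phi q (Suc k) lam))
    = (\<Prod>i<M. lin (maya q r lam i)) * inverse (\<Prod>i<M. lin (maya q r (\<lambda>_. 0) i))"
proof -
  define S where "S = (\<Sum>i<M. fps_log1m (maya q r lam i) + - fps_log1m (maya q r (\<lambda>_. 0) i))"
  have phi: "phi q k lam = (\<Sum>i<M. (q ^ lam i / q ^ i) ^ k - (1 / q ^ i) ^ k)" for k
  proof -
    have pw: "q powi (int k * (int l - int i)) = (q ^ l / q ^ i) ^ k" for l i
      using q by (simp add: mult.commute [of "int k"] power_int_mult power_int_diff)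
    have "phi q k lam = (\<Sum>i | lam i \<noteq> 0. (q ^ lam i / q ^ i) ^ k - (1 / q ^ i) ^ k)"
      unfolding phi_def using pw [of 0] by (simp add: pw)
    also have "\<dots> = (\<Sum>i<M. (q ^ lam i / q ^ i) ^ k - (1 / q ^ i) ^ k)"
    proof (rule sum.mono_neutral_left)
      show "{i. lam i \<noteq> 0} \<subseteq> {..<M}" using zero by (auto simp: not_less [symmetric])
    qed auto
    finally show ?thesis .
  qed
  have "- (fps_const (inverse r ^ Suc k / of_nat (Suc k)) * fps_X ^ Suc k) * fps_const (phi q (Suc k) lam)
    = fps_const (fps_nth S (Suc k)) * fps_X ^ Suc k" for k
  proof -
    have "fps_nth S (Suc k) = (\<Sum>i<M. - (inverse r ^ Suc k / of_nat (Suc k)) *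
        ((q ^ lam i / q ^ i) ^ Suc k - (1 / q ^ i) ^ Suc k))"
      unfolding S_def fps_sum_nth
      by (intro sum.cong refl)
        (simp add: fps_log1m_def maya_def power_divide power_mult_distrib divide_inverse algebra_simps
          del: of_nat_Suc power_Suc)
    also have "\<dots> = - (inverse r ^ Suc k / of_nat (Suc k)) * phi q (Suc k) lam"
      unfolding phi by (rule sum_distrib_left [symmetric])
    finally have "fps_const (fps_nth S (Suc k))
      = - fps_const (inverse r ^ Suc k / of_nat (Suc k)) * fps_const (phi q (Suc k) lam)"
      by (simp del: of_nat_Suc power_Suc)
    then show ?thesis by (simp only: mult_ac minus_mult_left [symmetric] minus_mult_right [symmetric])
  qed
  moreover have "fps_nth S 0 = 0"
    by (simp add: S_def fps_sum_nth fps_log1m_def)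
  ultimately have "(\<Sum>k. - (fps_const (inverse r ^ Suc k / of_nat (Suc k)) * fps_X ^ Suc k) *
      fps_const (phi q (Suc k) lam)) = S"
    by (simp only: suminf_fps_monomials)
  moreover have "fps_exp 1 oo S
    = (\<Prod>i<M. lin (maya q r lam i) * inverse (lin (maya q r (\<lambda>_. 0) i)))"
  proof -
    have log0: "fps_nth (fps_log1m a) 0 = 0" for a by (simp add: fps_log1m_def)
    then have "fps_exp 1 oo (fps_log1m a + - fps_log1m b) = lin a * inverse (lin b)" for a b
      by (subst fps_exp_compose_add) (simp_all add: fps_exp_log1m fps_exp_minus_log1m)
    with log0 show ?thesis unfolding S_def by (subst fps_exp_compose_sum) simp_all
  qed
  moreover have "inverse (\<Prod>i\<in>I. f i) = (\<Prod>i\<in>I. inverse (f i))" for I and f :: "nat \<Rightarrow> complex fps"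
    by (induction I rule: infinite_finite_induct) (simp_all add: fps_inverse_mult)
  ultimately show ?thesis by (simp add: prod.distrib)
qed

section \<open>Adding and removing boxes\<close>

definition partitions_of :: "nat \<Rightarrow> (nat \<Rightarrow> nat) set" where
  "partitions_of n = {lam \<in> partitions. weight lam = n}"

lemma weight_eq_sum:
  assumes "\<forall>i\<ge>M. lam i = 0"
  shows "weight lam = (\<Sum>i<M. lam i)"
  unfolding weight_def
proof (rule sum.mono_neutral_left)
  show "{i. lam i \<noteq> 0} \<subseteq> {..<M}" using assms by (auto simp: not_less [symmetric])
qed auto

lemma partitions_of_iff:
  assumes "\<forall>i\<ge>M. lam i = 0"
  shows "lam \<in> partitions_of n \<longleftrightarrow> antimono lam \<and> (\<Sum>i<M. lam i) = n"
proof -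
  have "{i. lam i \<noteq> 0} \<subseteq> {..<M}" using assms by (auto simp: not_less [symmetric])
  then have "finite {i. lam i \<noteq> 0}" by (rule finite_subset) simp
  then show ?thesis
    by (simp add: partitions_of_def partitions_def weight_eq_sum [OF assms])
qed

lemma partitions_of_antimono: "lam \<in> partitions_of n \<Longrightarrow> antimono lam"
  by (simp add: partitions_of_def partitions_def)

text \<open>Each nonzero part contributes at least 1 to the weight. This gives one row cut-off for
  all partitions of \<open>n\<close>.\<close>

lemma partitions_of_zero:
  assumes "lam \<in> partitions_of n" "n \<le> i"
  shows "lam i = 0"
proof (rule ccontr)
  assume "lam i \<noteq> 0"
  moreover have anti: "antimono lam" and fin: "finite {i. lam i \<noteq> 0}" and w: "weight lam = n"
    using assms(1) by (auto simp: partitions_of_def partitions_def)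
  ultimately have pos: "1 \<le> lam j" if "j \<in> {..i}" for j
    using antimonoD [OF anti, of j i] that by simp
  have "Suc i = (\<Sum>j\<in>{..i}. 1)" by simp
  also have "\<dots> \<le> (\<Sum>j\<in>{..i}. lam j)" using pos by (rule sum_mono)
  also have "\<dots> \<le> weight lam" unfolding weight_def
    using fin pos by (intro sum_mono2) (auto simp: Suc_le_eq)
  finally show False using w assms(2) by simp
qed

lemma finite_partitions_of: "finite (partitions_of n)"
proof (rule finite_subset)
  show "finite ((\<lambda>m i. if i < n then m i else 0) ` ({..<n} \<rightarrow>\<^sub>E {..n}))"
    by (intro finite_imageI finite_PiE) auto
  show "partitions_of n \<subseteq> (\<lambda>m i. if i < n then m i else 0) ` ({..<n} \<rightarrow>\<^sub>E {..n})"
  proof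
    fix lam assume lam: "lam \<in> partitions_of n"
    have zero: "\<forall>i\<ge>n. lam i = 0" using partitions_of_zero [OF lam] by blast
    have sum: "(\<Sum>i<n. lam i) = n" using lam partitions_of_iff [OF zero] by simp
    have "lam i \<le> n" if "i < n" for i
      using member_le_sum [of i "{..<n}" lam] that by (simp add: sum)
    then have "restrict lam {..<n} \<in> {..<n} \<rightarrow>\<^sub>E {..n}" by simp
    moreover have "lam = (\<lambda>i. if i < n then restrict lam {..<n} i else 0)"
      using zero by (auto simp: fun_eq_iff)
    ultimately show "lam \<in> (\<lambda>m i. if i < n then m i else 0) ` ({..<n} \<rightarrow>\<^sub>E {..n})"
      by (intro image_eqI [where x = "restrict lam {..<n}"])
  qed
qed

lemma antimono_remove_box:
  fixes lam :: "nat \<Rightarrow> nat"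
  assumes "antimono lam" "lam (Suc k) < lam k"
  shows "antimono (lam(k := lam k - 1))"
proof (rule decseq_SucI)
  fix i
  have "lam (Suc i) \<le> lam i" using assms(1) by (simp add: antimonoD)
  then show "(lam(k := lam k - 1)) (Suc i) \<le> (lam(k := lam k - 1)) i"
    using assms(2) by auto
qed

lemma antimono_add_box:
  fixes mu :: "nat \<Rightarrow> nat"
  assumes "antimono mu" "k = 0 \<or> mu k < mu (k - 1)"
  shows "antimono (mu(k := Suc (mu k)))"
proof (rule decseq_SucI)
  fix i
  have "mu (Suc i) \<le> mu i" using assms(1) by (simp add: antimonoD)
  then show "(mu(k := Suc (mu k))) (Suc i) \<le> (mu(k := Suc (mu k))) i"
    using assms(2) by auto
qed

section \<open>Residues in terms of neighbouring Schur values\<close>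

lemma maya_nonzero: "q \<noteq> 0 \<Longrightarrow> r \<noteq> 0 \<Longrightarrow> maya q r lam i \<noteq> 0"
  by (simp add: maya_def)

text \<open>The exponents \<open>lam i - i\<close> strictly decrease and q is not a root of unity;
  hence all poles are simple.\<close>

lemma inj_maya:
  assumes q: "0 < norm q" "norm q < 1" "r \<noteq> 0" and lam: "antimono lam"
  shows "inj (maya q r lam)"
proof (rule injI)
  fix i j assume eq: "maya q r lam i = maya q r lam j"
  have "q \<noteq> 0" using q(1) by auto
  then have "q ^ (lam i + j) = q ^ (lam j + i)"
    using eq q(3) by (simp add: maya_def power_add field_simps)
  then have "lam i + j = lam j + i" by (rule power_inject_norm_less_1 [OF q(1,2)])
  then show "i = j"
    using antimonoD [OF lam, of i j] antimonoD [OF lam, of j i] by (cases "i \<le> j") auto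
qed

lemma maya_add_box: "maya q r (mu(k := Suc (mu k))) = (maya q r mu)(k := q * maya q r mu k)"
  by (auto simp: maya_def fun_eq_iff)

lemma schur_rho_add_box_maya:
  assumes q: "0 < norm q" "norm q < 1" "r\<^sup>2 = q"
    and mu: "antimono mu" "\<forall>i\<ge>M. mu i = 0" and k: "k < M"
    and lam: "lam = mu(k := Suc (mu k))" "antimono lam"
  defines "b \<equiv> maya q r mu"
  shows "schur_rho r lam * (1 / r - q ^ M * b k) * (\<Prod>j\<in>{..<M} - {k}. b k - b j)
    = schur_rho r mu * (\<Prod>j\<in>{..<M} - {k}. q * b k - b j)"
proof -
  have q0: "q \<noteq> 0" and r0: "r \<noteq> 0" using q by auto
  let ?J = "{..<M} - {k}"
  \<comment> \<open>Each difference of nodes becomes a difference of the \<open>b\<close> divided by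
    one of these factors, the same in both products.\<close>
  define C where "C = (\<Prod>j\<in>?J. - (r * b k * b j))"
  have b0: "b j \<noteq> 0" for j using q0 r0 by (simp add: b_def maya_nonzero)
  have C: "C \<noteq> 0" using b0 r0 by (simp add: C_def)
  have node: "node q mu j = 1 / (r * b j)" for j
    using q0 r0 by (simp add: node_def b_def maya_def)
  have P1: "(\<Prod>j\<in>?J. node q mu k - node q mu j) = (\<Prod>j\<in>?J. b k - b j) / C"
    unfolding C_def prod_dividef [symmetric] node using b0 r0
    by (intro prod.cong refl) (simp add: field_simps)
  have P2: "(\<Prod>j\<in>?J. node q mu k - q * node q mu j) = (\<Prod>j\<in>?J. q * b k - b j) / C"
    unfolding C_def prod_dividef [symmetric] node using b0 r0
    by (intro prod.cong refl) (simp add: field_simps)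
  have "schur_rho r lam * (node q mu k - q ^ M) * (\<Prod>j\<in>?J. node q mu k - node q mu j)
    = r * schur_rho r mu * node q mu k * (\<Prod>j\<in>?J. node q mu k - q * node q mu j)"
    by (rule schur_rho_add_box [OF q mu k lam])
  from this [unfolded P1 P2, unfolded node]
  have "schur_rho r lam * (1 / (r * b k) - q ^ M) * (\<Prod>j\<in>?J. b k - b j)
    = schur_rho r mu * (1 / b k) * (\<Prod>j\<in>?J. q * b k - b j)"
    using C r0 b0 [of k] by (simp add: divide_simps mult.assoc)
  then have "b k * (schur_rho r lam * (1 / (r * b k) - q ^ M) * (\<Prod>j\<in>?J. b k - b j))
    = b k * (schur_rho r mu * (1 / b k) * (\<Prod>j\<in>?J. q * b k - b j))" by simp
  moreover have "1 / r - q ^ M * b k = b k * (1 / (r * b k) - q ^ M)"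
    using b0 r0 by (simp add: field_simps)
  ultimately show ?thesis using b0 [of k] by (simp add: mult_ac)
qed

text \<open>
  The residues of the partial fraction expansions, with one term for every row.  They vanish
  for rows in which no box can be removed or added.
\<close>

definition removal_coeff :: "complex \<Rightarrow> complex \<Rightarrow> nat \<Rightarrow> (nat \<Rightarrow> nat) \<Rightarrow> nat \<Rightarrow> complex" where
  "removal_coeff q r M lam i = - (\<Prod>j\<le>M. maya q r lam i - q * maya q r lam j)
     / (maya q r lam i * (\<Prod>j\<in>{..<M} - {i}. maya q r lam i - maya q r lam j))"

definition addition_coeff :: "complex \<Rightarrow> complex \<Rightarrow> nat \<Rightarrow> (nat \<Rightarrow> nat) \<Rightarrow> nat \<Rightarrow> complex" where
  "addition_coeff q r m mu i = (\<Prod>j<m. maya q r mu i - maya q r mu j / q)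
     / (maya q r mu i * (\<Prod>j\<in>{..m} - {i}. maya q r mu i - maya q r mu j))"

text \<open>The numerator factor of row \<open>k\<close> itself gives \<open>1 - q\<close>; the
  other factors form the ratio of the Schur values in \<open>schur_rho_add_box_maya\<close>. The
  product form avoids dividing by a Schur value.\<close>

lemma removal_coeff_add_box:
  assumes q: "0 < norm q" "norm q < 1" "r\<^sup>2 = q"
    and mu: "antimono mu" "\<forall>i\<ge>M. mu i = 0" and k: "k < M"
    and lam: "lam = mu(k := Suc (mu k))" "antimono lam"
  shows "removal_coeff q r M lam k * schur_rho r lam = (1 - q) * schur_rho r mu"
proof -
  have q0: "q \<noteq> 0" and r0: "r \<noteq> 0" using q by auto
  define b where "b = maya q r mu"
  let ?J = "{..<M} - {k}"
  have a: "maya q r lam = b(k := q * b k)" unfolding lam b_def by (rule maya_add_box)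
  have b0: "b j \<noteq> 0" for j using q0 r0 by (simp add: b_def maya_nonzero)
  have ne: "q * b k - b j \<noteq> 0" if "j \<in> ?J" for j
    using injD [OF inj_maya [OF q(1,2) r0 lam(2)], of k j] that by (auto simp: a)
  have bM: "b M = 1 / (r * q ^ M)" using mu(2) by (simp add: b_def maya_def)
  have "(\<Prod>j\<le>M. q * b k - q * (b(k := q * b k)) j)
    = (\<Prod>j<M. q * b k - q * (b(k := q * b k)) j) * (q * b k - q * b M)"
    using k by (simp add: lessThan_Suc_atMost [symmetric])
  also have "(\<Prod>j<M. q * b k - q * (b(k := q * b k)) j)
    = (q * b k - q * (q * b k)) * (\<Prod>j\<in>?J. q * b k - q * (b(k := q * b k)) j)"
    using k prod.remove [of "{..<M}" k "\<lambda>j. q * b k - q * (b(k := q * b k)) j"] by simp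
  also have "(\<Prod>j\<in>?J. q * b k - q * (b(k := q * b k)) j) = (\<Prod>j\<in>?J. q * (b k - b j))"
    by (intro prod.cong) (auto simp: algebra_simps)
  also have "\<dots> = q ^ (M - 1) * (\<Prod>j\<in>?J. b k - b j)"
    using k by (simp add: prod.distrib)
  finally have num: "(\<Prod>j\<le>M. q * b k - q * (b(k := q * b k)) j)
    = (q * b k - q * (q * b k)) * (q ^ (M - 1) * (\<Prod>j\<in>?J. b k - b j)) * (q * b k - q * b M)" .
  have den: "(\<Prod>j\<in>?J. q * b k - (b(k := q * b k)) j) = (\<Prod>j\<in>?J. q * b k - b j)"
    by (intro prod.cong) auto
  have qM: "q ^ (M - 1) * q = q ^ M" using k by (cases M) simp_all
  \<comment> \<open>Since \<open>q ^ M * b M = 1 / r\<close>, the numerator factor of the empty row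
    \<open>M\<close> becomes the boundary factor in \<open>schur_rho_add_box_maya\<close>.\<close>
  have scalar: "- ((q * b k - q * (q * b k)) * (q ^ (M - 1) * P) * (q * b k - q * b M))
      = (1 - q) * (q * b k) * (1 / r - q ^ M * b k) * P" for P
  proof -
    have "- ((q * b k - q * (q * b k)) * (q ^ (M - 1) * P) * (q * b k - q * b M))
      = (1 - q) * (q * b k) * (q ^ (M - 1) * q * (b M - b k)) * P"
      by (simp add: algebra_simps)
    also have "q ^ (M - 1) * q * (b M - b k) = 1 / r - q ^ M * b k"
      unfolding qM bM using q0 r0 by (simp add: field_simps)
    finally show ?thesis .
  qed
  have "removal_coeff q r M lam k
    = (1 - q) * (q * b k) * (1 / r - q ^ M * b k) * (\<Prod>j\<in>?J. b k - b j)
      / (q * b k * (\<Prod>j\<in>?J. q * b k - b j))"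
    unfolding removal_coeff_def a fun_upd_same num den scalar ..
  also have "\<dots> = (1 - q) * (1 / r - q ^ M * b k) * (\<Prod>j\<in>?J. b k - b j) / (\<Prod>j\<in>?J. q * b k - b j)"
    using q0 b0 by simp
  finally have "removal_coeff q r M lam k * schur_rho r lam
    = (1 - q) * (schur_rho r lam * (1 / r - q ^ M * b k) * (\<Prod>j\<in>?J. b k - b j)) / (\<Prod>j\<in>?J. q * b k - b j)"
    by simp
  also have "\<dots> = (1 - q) * schur_rho r mu"
    using schur_rho_add_box_maya [OF q mu k lam] ne by (simp add: b_def)
  finally show ?thesis .
qed

text \<open>The vanishing factor is that of row \<open>Suc k\<close>, which may be \<open>M\<close>:
  the numerator includes row \<open>M\<close> for this reason too.\<close>

lemma removal_coeff_eq_0: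
  assumes "k < M" "lam k = lam (Suc k)" "q \<noteq> 0"
  shows "removal_coeff q r M lam k = 0"
proof -
  have "maya q r lam k - q * maya q r lam (Suc k) = 0"
    using assms(2,3) by (simp add: maya_def)
  then have "(\<Prod>j\<le>M. maya q r lam k - q * maya q r lam j) = 0"
    using assms(1) by (intro prod_zero) (auto intro!: bexI[of _ "Suc k"])
  then show ?thesis by (simp add: removal_coeff_def)
qed

text \<open>The numerator runs over \<open>m\<close> rows only; completed by row \<open>m\<close> it
  contains the factor of row \<open>k\<close>, which gives \<open>1 - q\<close>. That includes
  \<open>k = m\<close>, where the box starts a new row.\<close>

lemma addition_coeff_add_box:
  assumes q: "0 < norm q" "norm q < 1" "r\<^sup>2 = q"
    and mu: "antimono mu" "\<forall>i\<ge>m. mu i = 0" and k: "k < Suc m"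
    and lam: "lam = mu(k := Suc (mu k))" "antimono lam"
  shows "addition_coeff q r m mu k * schur_rho r mu = (1 - q) * schur_rho r lam"
proof -
  have q0: "q \<noteq> 0" and r0: "r \<noteq> 0" using q by auto
  define b where "b = maya q r mu"
  let ?J = "{..<Suc m} - {k}"
  have J: "{..m} - {k} = ?J" by auto
  have b0: "b j \<noteq> 0" for j using q0 r0 by (simp add: b_def maya_nonzero)
  note inj = injD [OF inj_maya [OF q(1,2) r0 mu(1)], folded b_def]
  have ne: "b k - b j \<noteq> 0" if "j \<in> ?J" for j using inj [of k j] that by auto
  have bm: "b m / q = 1 / (r * q ^ Suc m)" "b (Suc m) = 1 / (r * q ^ Suc m)"
    using mu(2) by (simp_all add: b_def maya_def)
  \<comment> \<open>The missing factor can be cancelled because \<open>b m / q\<close> is the Maya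
    value of row \<open>Suc m\<close>.\<close>
  have last: "b k - b m / q \<noteq> 0" using inj [of k "Suc m"] k bm by auto
  have lead: "1 / r - q ^ Suc m * b k = - (q ^ Suc m * (b k - b m / q))"
    unfolding bm using q0 r0 by (simp add: field_simps del: power_Suc)
  let ?A = "\<Prod>j<m. b k - b j / q" and ?P = "\<Prod>j\<in>?J. b k - b j" and ?R = "\<Prod>j\<in>?J. q * b k - b j"
  have P: "?P \<noteq> 0" using ne by simp
  have "?A * (b k - b m / q) = (\<Prod>j<Suc m. b k - b j / q)" by simp
  also have "\<dots> = (b k - b k / q) * (\<Prod>j\<in>?J. b k - b j / q)"
    using k by (intro prod.remove) auto
  also have "(\<Prod>j\<in>?J. b k - b j / q) = (\<Prod>j\<in>?J. (q * b k - b j) / q)"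
    using q0 by (intro prod.cong) (auto simp: field_simps)
  also have "\<dots> = ?R / q ^ m"
    using k by (simp add: prod_dividef)
  finally have A: "?A * (b k - b m / q) = (b k - b k / q) * (?R / q ^ m)" .
  have R: "schur_rho r lam * (1 / r - q ^ Suc m * b k) * ?P = schur_rho r mu * ?R"
    using schur_rho_add_box_maya [OF q mu(1) _ k lam] mu(2) by (simp add: b_def del: power_Suc)
  have "?A * schur_rho r mu * (b k - b m / q) = ?A * (b k - b m / q) * schur_rho r mu"
    by (simp only: mult_ac)
  also have "\<dots> = (b k - b k / q) / q ^ m * (schur_rho r mu * ?R)"
    unfolding A by simp
  also have "\<dots> = (b k - b k / q) / q ^ m * (schur_rho r lam * - (q ^ Suc m * (b k - b m / q)) * ?P)"
    unfolding R [symmetric] lead ..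
  also have "\<dots> = (1 - q) * schur_rho r lam * (b k * ?P) * (b k - b m / q)"
    using q0 by (simp add: field_simps)
  finally have "?A * schur_rho r mu = (1 - q) * schur_rho r lam * (b k * ?P)"
    using last by simp
  then show ?thesis
    unfolding addition_coeff_def b_def [symmetric] J using b0 [of k] P by simp
qed

text \<open>The row above supplies the vanishing factor. Row 0 has none above it, and a box can
  always be added there.\<close>

lemma addition_coeff_eq_0:
  assumes "Suc k \<le> m" "mu k = mu (Suc k)" "q \<noteq> 0"
  shows "addition_coeff q r m mu (Suc k) = 0"
proof -
  have "maya q r mu (Suc k) - maya q r mu k / q = 0"
    using assms(2,3) by (simp add: maya_def)
  then have "(\<Prod>j<m. maya q r mu (Suc k) - maya q r mu j / q) = 0"
    using assms(1) by (intro prod_zero) (auto intro!: bexI[of _ k])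
  then show ?thesis by (simp add: addition_coeff_def)
qed

section \<open>The difference equation\<close>

text \<open>F_lambda cut off after \<open>M\<close> rows; empty rows cancel, so any \<open>M\<close>
  beyond the last nonzero part gives the same series.\<close>

definition potential :: "complex \<Rightarrow> complex \<Rightarrow> nat \<Rightarrow> (nat \<Rightarrow> nat) \<Rightarrow> complex fps" where
  "potential q r M lam = (\<Prod>i<M. lin (maya q r lam i)) * inverse (\<Prod>i<M. lin (maya q r (\<lambda>_. 0) i))"

text \<open>The simple-pole term of row \<open>i\<close>. It does not involve \<open>lam i\<close>,
  so partitions that differ in row \<open>i\<close> alone share it.\<close>

definition punctured_potential :: "complex \<Rightarrow> complex \<Rightarrow> nat \<Rightarrow> (nat \<Rightarrow> nat) \<Rightarrow> nat \<Rightarrow> complex fps" where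
  "punctured_potential q r M lam i =
     (\<Prod>j\<in>{..<M} - {i}. lin (maya q r lam j)) * inverse (\<Prod>i<M. lin (maya q r (\<lambda>_. 0) i))"

text \<open>The cut-off stays free because the same coefficient is used with \<open>m\<close> and
  with \<open>Suc m\<close> rows.\<close>

lemma Z_single_nth:
  assumes "q \<noteq> 0" "n \<le> M"
  shows "fps_nth (Z_single q r) n
    = (\<Sum>lam\<in>partitions_of n. fps_const ((schur_rho r lam)\<^sup>2) * potential q r M lam)"
proof -
  have "fps_nth (Z_single q r) n = (\<Sum>lam\<in>partitions_of n. fps_const ((schur_rho r lam)\<^sup>2) *
     (fps_exp 1 oo (\<Sum>k. - (fps_const (inverse r ^ Suc k / of_nat (Suc k)) * fps_X ^ Suc k) *
        fps_const (phi q (Suc k) lam))))"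
    by (simp only: Z_single_def Z_deformed_def fps_nth_Abs_fps partitions_of_def)
  also have "\<dots> = (\<Sum>lam\<in>partitions_of n. fps_const ((schur_rho r lam)\<^sup>2) * potential q r M lam)"
  proof (rule sum.cong [OF refl])
    fix lam assume "lam \<in> partitions_of n"
    then have "\<forall>i\<ge>M. lam i = 0" using partitions_of_zero assms(2) by (meson order_trans)
    then show "fps_const ((schur_rho r lam)\<^sup>2) *
       (fps_exp 1 oo (\<Sum>k. - (fps_const (inverse r ^ Suc k / of_nat (Suc k)) * fps_X ^ Suc k) *
          fps_const (phi q (Suc k) lam))) = fps_const ((schur_rho r lam)\<^sup>2) * potential q r M lam"
      by (simp only: exp_potential [OF assms(1)] potential_def)
  qed
  finally show ?thesis .
qed

section \<open>Dilations of the potential\<close>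

lemma prod_lin_nth_0: "fps_nth (\<Prod>i\<in>I. lin (a i)) 0 = 1"
  by (induction I rule: infinite_finite_induct) simp_all

lemma lin_compose: "lin a oo (fps_const c * fps_X) = lin (c * a)"
proof -
  have "fps_const a * fps_X oo (fps_const c * fps_X) = fps_const (c * a) * fps_X"
    by (subst fps_compose_mult_distrib) (simp_all add: fps_const_mult [symmetric] mult_ac del: fps_const_mult)
  then show ?thesis by (simp add: fps_compose_sub_distrib)
qed

lemma prod_lin_compose: "(\<Prod>i\<in>I. lin (a i)) oo (fps_const c * fps_X) = (\<Prod>i\<in>I. lin (c * a i))"
  by (subst fps_compose_prod_distrib) (simp_all only: lin_compose, simp)

lemma potential_compose:
  "potential q r M lam oo (fps_const c * fps_X)
    = (\<Prod>i<M. lin (c * maya q r lam i)) * inverse (\<Prod>i<M. lin (c * maya q r (\<lambda>_. 0) i))"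
proof -
  have c0: "fps_nth (fps_const c * fps_X) 0 = 0" by simp
  show ?thesis
    unfolding potential_def
    by (subst fps_compose_mult_distrib [OF c0], subst fps_inverse_compose [OF c0])
      (simp_all only: prod_lin_nth_0 prod_lin_compose, simp)
qed

lemma inverse_prod_lin: "(\<Prod>i\<in>I. lin (a i)) * inverse (\<Prod>i\<in>I. lin (a i)) = 1"
  by (rule inverse_mult_eq_1') (simp only: prod_lin_nth_0, simp)

text \<open>The prefactor \<open>lin r\<close> restores the row lost from the dilated denominator
  and leaves \<open>lin\<close> of row \<open>M\<close> in the numerator, which therefore has
  \<open>Suc M\<close> factors.\<close>

lemma potential_shift_up:
  assumes q: "0 < norm q" "norm q < 1" "r\<^sup>2 = q"
    and lam: "antimono lam" "\<forall>i\<ge>M. lam i = 0"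
  shows "lin r * (potential q r M lam oo (fps_const q * fps_X)) - lin r * potential q r M lam
    = - (fps_X * (\<Sum>i<M. fps_const (removal_coeff q r M lam i) * punctured_potential q r M lam i))"
proof -
  have q0: "q \<noteq> 0" and r0: "r \<noteq> 0" using q by auto
  let ?a = "maya q r lam" and ?o = "maya q r (\<lambda>_. 0)"
  define D where "D = (\<Prod>i<M. lin (?o i))"
  define D' where "D' = (\<Prod>i<M. lin (q * ?o i))"
  have inv: "D * inverse D = 1" "D' * inverse D' = 1"
    unfolding D_def D'_def by (rule inverse_prod_lin)+
  have o: "q * ?o 0 = r" "q * ?o (Suc i) = ?o i" for i
    using q0 r0 q(3) by (simp_all add: maya_def power2_eq_square field_simps)
  have aM: "?a M = ?o M" using lam(2) by (simp add: maya_def)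
  \<comment> \<open>Dilation by q turns empty row \<open>Suc i\<close> into row \<open>i\<close> and
    row 0 into \<open>r\<close>.\<close>
  have "D' * lin (q * ?o M) = (\<Prod>i<Suc M. lin (q * ?o i))" by (simp add: D'_def)
  also have "\<dots> = lin r * D"
    unfolding prod.lessThan_Suc_shift o D_def by (simp only: o_def)
  finally have "D' * lin (q * ?a M) = lin r * D" by (simp only: aM)
  note cross = this
  have "lin r * inverse D' = lin r * inverse D' * (D * inverse D)"
    by (simp only: inv mult_1_right)
  also have "\<dots> = D' * lin (q * ?a M) * (inverse D' * inverse D)"
    unfolding cross by (simp only: mult_ac)
  also have "\<dots> = lin (q * ?a M) * inverse D * (D' * inverse D')"
    by (simp only: mult_ac)
  finally have shift: "lin r * inverse D' = lin (q * ?a M) * inverse D"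
    by (simp only: inv mult_1_right)
  have nz: "?a i \<noteq> 0" for i using q0 r0 by (rule maya_nonzero)
  have inj: "inj_on ?a {..<M}"
    by (rule inj_on_subset [OF inj_maya [OF q(1,2) r0 lam(1)]]) simp
  have "(\<Prod>i\<le>M. lin (q * ?a i)) = lin r * (\<Prod>i<M. lin (?a i))
    - fps_X * (\<Sum>i<M. fps_const (removal_coeff q r M lam i) * (\<Prod>j\<in>{..<M} - {i}. lin (?a j)))"
  proof (rule partial_fractions_removable [OF inj nz])
    show "q ^ Suc M * ?a M = r"
      unfolding aM using o(1) q0 by (simp add: maya_def)
    fix i assume "i < M"
    have "(\<Prod>j\<in>{..<M} - {i}. ?a i - ?a j) \<noteq> 0"
      using inj \<open>i < M\<close> by (auto simp: inj_on_def)
    then show "(\<Prod>j\<le>M. ?a i - q * ?a j)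
      = - removal_coeff q r M lam i * ?a i * (\<Prod>j\<in>{..<M} - {i}. ?a i - ?a j)"
      using nz [of i] by (simp add: removal_coeff_def)
  qed
  then have pf: "(\<Prod>i<M. lin (q * ?a i)) * lin (q * ?a M) = lin r * (\<Prod>i<M. lin (?a i))
    - fps_X * (\<Sum>i<M. fps_const (removal_coeff q r M lam i) * (\<Prod>j\<in>{..<M} - {i}. lin (?a j)))"
    unfolding lessThan_Suc_atMost [symmetric] prod.lessThan_Suc .
  have "lin r * (potential q r M lam oo (fps_const q * fps_X))
    = (\<Prod>i<M. lin (q * ?a i)) * (lin r * inverse D')"
    unfolding potential_compose D'_def by (simp only: mult_ac)
  also have "\<dots> = (\<Prod>i<M. lin (q * ?a i)) * lin (q * ?a M) * inverse D"
    unfolding shift by (simp only: mult_ac)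
  also have "\<dots> = lin r * potential q r M lam
      - fps_X * (\<Sum>i<M. fps_const (removal_coeff q r M lam i) * punctured_potential q r M lam i)"
    unfolding pf left_diff_distrib mult.assoc sum_distrib_right potential_def punctured_potential_def D_def ..
  finally show ?thesis by simp
qed

text \<open>The inverse dilation moves empty row \<open>i\<close> to row \<open>Suc i\<close>, and
  the inverse of \<open>lin (inverse r)\<close> supplies row 0. Hence the dilated potential with
  \<open>m\<close> rows has the denominator of the undilated one with \<open>Suc m\<close>
  rows.\<close>

lemma potential_shift_down:
  assumes q: "0 < norm q" "norm q < 1" "r\<^sup>2 = q"
    and mu: "antimono mu" "\<forall>i\<ge>m. mu i = 0"
  shows "fps_const r * fps_X * potential q r (Suc m) mu
      + fps_X\<^sup>2 * inverse (lin (inverse r)) * (potential q r m mu oo (fps_const (inverse q) * fps_X))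
    = fps_X * (\<Sum>i<Suc m. fps_const (addition_coeff q r m mu i) * punctured_potential q r (Suc m) mu i)"
proof -
  have q0: "q \<noteq> 0" and r0: "r \<noteq> 0" using q by auto
  let ?b = "maya q r mu" and ?o = "maya q r (\<lambda>_. 0)"
  define D where "D = (\<Prod>i<Suc m. lin (?o i))"
  define D' where "D' = (\<Prod>i<m. lin (inverse q * ?o i))"
  have o: "?o 0 = inverse r" "?o (Suc i) = inverse q * ?o i" for i
    using q0 r0 by (simp_all add: maya_def field_simps)
  have "D = lin (inverse r) * D'"
    unfolding D_def prod.lessThan_Suc_shift o D'_def by (simp only: o_def o)
  then have shift: "inverse D = inverse (lin (inverse r)) * inverse D'"
    by (simp only: fps_inverse_mult)
  have nz: "?b i \<noteq> 0" for i using q0 r0 by (rule maya_nonzero)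
  have inj: "inj_on ?b {..m}"
    by (rule inj_on_subset [OF inj_maya [OF q(1,2) r0 mu(1)]]) simp
  have pf: "fps_X * (\<Prod>i<m. lin (?b i / q)) + fps_const r * (\<Prod>i\<le>m. lin (?b i))
    = (\<Sum>i\<le>m. fps_const (addition_coeff q r m mu i) * (\<Prod>j\<in>{..m} - {i}. lin (?b j)))"
  proof (rule partial_fractions_addable [OF inj nz])
    show "r * ?b m * q ^ m = 1"
      using q0 r0 mu(2) by (simp add: maya_def)
    fix i assume "i \<le> m"
    then have "(\<Prod>j\<in>{..m} - {i}. ?b i - ?b j) \<noteq> 0"
      using inj by (auto simp: inj_on_def)
    then show "(\<Prod>j<m. ?b i - ?b j / q)
      = addition_coeff q r m mu i * ?b i * (\<Prod>j\<in>{..m} - {i}. ?b i - ?b j)"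
      using nz [of i] by (simp add: addition_coeff_def)
  qed
  have "fps_const r * fps_X * potential q r (Suc m) mu
      + fps_X\<^sup>2 * inverse (lin (inverse r)) * (potential q r m mu oo (fps_const (inverse q) * fps_X))
    = fps_X * (fps_const r * (\<Prod>i<Suc m. lin (?b i))) * inverse D
      + fps_X * (fps_X * (\<Prod>i<m. lin (inverse q * ?b i))) * (inverse (lin (inverse r)) * inverse D')"
    unfolding potential_compose unfolding potential_def D'_def D_def power2_eq_square
    by (simp only: mult_ac)
  also have "\<dots> = fps_X * (fps_X * (\<Prod>i<m. lin (?b i / q)) + fps_const r * (\<Prod>i<Suc m. lin (?b i))) * inverse D"
    unfolding shift [symmetric] by (simp only: distrib_left distrib_right add.commute divide_inverse mult.commute [of "inverse q"])
  also have "\<dots> = fps_X * (\<Sum>i<Suc m. fps_const (addition_coeff q r m mu i) *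
      (\<Prod>j\<in>{..<Suc m} - {i}. lin (?b j))) * inverse D"
    unfolding lessThan_Suc_atMost pf ..
  also have "\<dots> = fps_X * (\<Sum>i<Suc m. fps_const (addition_coeff q r m mu i) * punctured_potential q r (Suc m) mu i)"
    unfolding mult.assoc sum_distrib_right punctured_potential_def D_def ..
  finally show ?thesis .
qed

text \<open>For a pair that differs by a box in row \<open>i\<close>, both summands are
  \<open>1 - q\<close> times the product of the two Schur values times the shared punctured
  potential.\<close>

lemma sum_remove_box_eq_sum_add_box:
  assumes q: "0 < norm q" "norm q < 1" "r\<^sup>2 = q"
  shows "(\<Sum>lam\<in>partitions_of (Suc m). \<Sum>i<Suc m. fps_const ((schur_rho r lam)\<^sup>2 * removal_coeff q r (Suc m) lam i)
        * punctured_potential q r (Suc m) lam i)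
    = (\<Sum>mu\<in>partitions_of m. \<Sum>i<Suc m. fps_const ((schur_rho r mu)\<^sup>2 * addition_coeff q r m mu i)
        * punctured_potential q r (Suc m) mu i)"
proof -
  have q0: "q \<noteq> 0" using q by auto
  let ?M = "Suc m"
  define f where "f = (\<lambda>(lam, i). fps_const ((schur_rho r lam)\<^sup>2 * removal_coeff q r ?M lam i)
        * punctured_potential q r ?M lam i)"
  define g where "g = (\<lambda>(mu, i). fps_const ((schur_rho r mu)\<^sup>2 * addition_coeff q r m mu i)
        * punctured_potential q r ?M mu i)"
  \<comment> \<open>Outside \<open>R\<close> and \<open>A\<close> the coefficients vanish; between
    them, removing and adding the box in row \<open>i\<close> are inverse bijections.\<close>
  define R where "R = {(lam, i). lam \<in> partitions_of ?M \<and> i < ?M \<and> lam (Suc i) < lam i}"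
  define A where "A = {(mu, i). mu \<in> partitions_of m \<and> i < ?M \<and> (i = 0 \<or> mu i < mu (i - 1))}"
  have sum_upd: "(\<Sum>j<?M. (lam(i := x)) j) + lam i = (\<Sum>j<?M. lam j) + x" if "i < ?M" for lam :: "nat \<Rightarrow> nat" and i x
    using that by (simp add: sum.remove [of "{..<?M}" i] del: sum.lessThan_Suc)
  have zero: "\<forall>i\<ge>?M. lam i = 0" if "lam \<in> partitions_of n" "n \<le> ?M" for lam n
    using partitions_of_zero [OF that(1)] that(2) by (meson order_trans)
  have "(\<Sum>lam\<in>partitions_of ?M. \<Sum>i<?M. f (lam, i)) = sum f (partitions_of ?M \<times> {..<?M})"
    by (simp add: sum.cartesian_product del: sum.lessThan_Suc)
  also have "\<dots> = sum f R"
  proof (rule sum.mono_neutral_right)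
    show "\<forall>x\<in>partitions_of ?M \<times> {..<?M} - R. f x = 0"
    proof
      fix x assume x: "x \<in> partitions_of ?M \<times> {..<?M} - R"
      obtain lam i where [simp]: "x = (lam, i)" by (cases x)
      have lam: "lam \<in> partitions_of ?M" and i: "i < ?M" "\<not> lam (Suc i) < lam i"
        using x by (auto simp: R_def)
      have "lam (Suc i) \<le> lam i" using partitions_of_antimono [OF lam] by (simp add: antimonoD)
      with i have "lam i = lam (Suc i)" by simp
      then have "removal_coeff q r ?M lam i = 0" using i(1) q0 by (intro removal_coeff_eq_0)
      then show "f x = 0" by (simp add: f_def)
    qed
  qed (auto simp: R_def finite_partitions_of)
  also have "\<dots> = sum g A"
  proof (rule sum.reindex_bij_witness
      [of _ "\<lambda>(mu, i). (mu(i := Suc (mu i)), i)" "\<lambda>(lam, i). (lam(i := lam i - 1), i)"], goal_cases)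
    case (1 x)
    then show ?case by (auto simp: R_def fun_eq_iff)
  next
    case (2 x)
    obtain lam i where [simp]: "x = (lam, i)" by (cases x)
    have lam: "lam \<in> partitions_of ?M" and i: "i < ?M" "lam (Suc i) < lam i"
      using 2 by (auto simp: R_def)
    let ?mu = "lam(i := lam i - 1)"
    have anti: "antimono lam" by (rule partitions_of_antimono [OF lam])
    have z: "\<forall>j\<ge>?M. lam j = 0" by (rule zero [OF lam]) simp
    then have z': "\<forall>j\<ge>?M. ?mu j = 0" using i by auto
    have "(\<Sum>j<?M. lam j) = ?M" using lam partitions_of_iff [OF z] by blast
    then have "(\<Sum>j<?M. ?mu j) = m" using sum_upd [OF i(1), of lam "lam i - 1"] i(2) by linarith
    then have "?mu \<in> partitions_of m"
      using partitions_of_iff [OF z'] antimono_remove_box [OF anti i(2)] by blast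
    moreover have "i = 0 \<or> ?mu i < ?mu (i - 1)"
      using i antimonoD [OF anti, of "i - 1" i] by (cases i) auto
    ultimately show ?case using i by (auto simp: A_def)
  next
    case (3 x)
    then show ?case by (auto simp: A_def)
  next
    case (4 x)
    obtain mu i where [simp]: "x = (mu, i)" by (cases x)
    have mu: "mu \<in> partitions_of m" and i: "i < ?M" "i = 0 \<or> mu i < mu (i - 1)"
      using 4 by (auto simp: A_def)
    let ?lam = "mu(i := Suc (mu i))"
    have anti: "antimono mu" by (rule partitions_of_antimono [OF mu])
    have z: "\<forall>j\<ge>?M. mu j = 0" by (rule zero [OF mu]) simp
    then have z': "\<forall>j\<ge>?M. ?lam j = 0" using i by auto
    have "(\<Sum>j<?M. mu j) = m" using mu partitions_of_iff [OF z] by blast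
    then have "(\<Sum>j<?M. ?lam j) = ?M" using sum_upd [OF i(1), of mu "Suc (mu i)"] by linarith
    then have "?lam \<in> partitions_of ?M"
      using partitions_of_iff [OF z'] antimono_add_box [OF anti i(2)] by blast
    moreover have "mu (Suc i) \<le> mu i" using anti by (simp add: antimonoD)
    ultimately show ?case using i by (auto simp: R_def)
  next
    case (5 x)
    obtain lam i where [simp]: "x = (lam, i)" by (cases x)
    have lam: "lam \<in> partitions_of ?M" and i: "i < ?M" "lam (Suc i) < lam i"
      using 5 by (auto simp: R_def)
    define mu where "mu = lam(i := lam i - 1)"
    have lam_eq: "lam = mu(i := Suc (mu i))" using i by (auto simp: mu_def)
    have anti: "antimono lam" by (rule partitions_of_antimono [OF lam])
    have anti_mu: "antimono mu" unfolding mu_def by (rule antimono_remove_box [OF anti i(2)])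
    have z: "\<forall>j\<ge>?M. lam j = 0" by (rule zero [OF lam]) simp
    then have z_mu: "\<forall>j\<ge>?M. mu j = 0" using i by (auto simp: mu_def)
    have "(\<Sum>j<?M. lam j) = ?M" using lam partitions_of_iff [OF z] by blast
    then have "(\<Sum>j<?M. mu j) = m"
      unfolding mu_def using sum_upd [OF i(1), of lam "lam i - 1"] i(2) by linarith
    then have "mu \<in> partitions_of m" using partitions_of_iff [OF z_mu] anti_mu by blast
    \<comment> \<open>The smaller partition has at most \<open>m\<close> rows even if
      \<open>lam\<close> has \<open>Suc m\<close>, as \<open>addition_coeff\<close> with parameter
      \<open>m\<close> requires.\<close>
    then have z_mu': "\<forall>j\<ge>m. mu j = 0" using partitions_of_zero by blast
    have "removal_coeff q r ?M lam i * schur_rho r lam = (1 - q) * schur_rho r mu"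
      by (rule removal_coeff_add_box [OF q anti_mu z_mu i(1) lam_eq anti])
    moreover have "addition_coeff q r m mu i * schur_rho r mu = (1 - q) * schur_rho r lam"
      by (rule addition_coeff_add_box [OF q anti_mu z_mu' i(1) lam_eq anti])
    moreover have "x\<^sup>2 * c = y\<^sup>2 * d" if "c * x = (1 - q) * y" "d * y = (1 - q) * x" for c d x y
    proof -
      have "x\<^sup>2 * c = x * (c * x)" "y\<^sup>2 * d = y * (d * y)"
        by (simp_all only: power2_eq_square mult_ac)
      then show ?thesis unfolding that by (simp only: mult_ac)
    qed
    ultimately have "(schur_rho r lam)\<^sup>2 * removal_coeff q r ?M lam i
        = (schur_rho r mu)\<^sup>2 * addition_coeff q r m mu i"
      by blast
    moreover have "punctured_potential q r ?M lam i = punctured_potential q r ?M mu i"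
    proof -
      have "(\<Prod>j\<in>{..<?M} - {i}. lin (maya q r lam j)) = (\<Prod>j\<in>{..<?M} - {i}. lin (maya q r mu j))"
        by (intro prod.cong) (auto simp: maya_def mu_def)
      then show ?thesis by (simp only: punctured_potential_def)
    qed
    ultimately show ?case by (simp add: f_def g_def mu_def)
  qed
  also have "\<dots> = sum g (partitions_of m \<times> {..<?M})"
  proof (rule sum.mono_neutral_left)
    show "\<forall>x\<in>partitions_of m \<times> {..<?M} - A. g x = 0"
    proof
      fix x assume x: "x \<in> partitions_of m \<times> {..<?M} - A"
      obtain mu i where [simp]: "x = (mu, i)" by (cases x)
      have mu: "mu \<in> partitions_of m" and i: "i < ?M" "i \<noteq> 0" "\<not> mu i < mu (i - 1)"
        using x by (auto simp: A_def)
      then obtain k where k: "i = Suc k" by (cases i) auto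
      have "mu (Suc k) \<le> mu k" using partitions_of_antimono [OF mu] by (simp add: antimonoD)
      with i k have "mu k = mu (Suc k)" by simp
      then have "addition_coeff q r m mu i = 0" using i(1) q0 unfolding k by (intro addition_coeff_eq_0) simp_all
      then show "g x = 0" by (simp add: g_def)
    qed
  qed (auto simp: A_def finite_partitions_of)
  also have "\<dots> = (\<Sum>mu\<in>partitions_of m. \<Sum>i<?M. g (mu, i))"
    by (simp add: sum.cartesian_product del: sum.lessThan_Suc)
  finally show ?thesis by (simp only: f_def g_def prod.case)
qed

text \<open>This is the coefficient of Q^(m+1) in the equation: the part of A - 1 free of Q acts on
  the coefficient of Q^(m+1), the other part on that of Q^m.\<close>

lemma Z_single_recursion:
  assumes q: "0 < norm q" "norm q < 1" "r\<^sup>2 = q"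
  defines "Z \<equiv> fps_nth (Z_single q r)"
  shows "lin r * (Z (Suc m) oo (fps_const q * fps_X)) - lin r * Z (Suc m)
    + (fps_const r * fps_X * Z m
      + fps_X\<^sup>2 * inverse (lin (inverse r)) * (Z m oo (fps_const (inverse q) * fps_X))) = 0"
proof -
  have q0: "q \<noteq> 0" using q by auto
  let ?M = "Suc m" and ?w = "\<lambda>lam. fps_const ((schur_rho r lam)\<^sup>2)"
  have comp: "(\<Sum>lam\<in>P. ?w lam * h lam) oo (fps_const c * fps_X)
      = (\<Sum>lam\<in>P. ?w lam * (h lam oo (fps_const c * fps_X)))" for P h c
    by (simp add: fps_compose_sum_distrib fps_compose_mult_distrib)
  have "lin r * (Z ?M oo (fps_const q * fps_X)) - lin r * Z ?M
    = (\<Sum>lam\<in>partitions_of ?M. ?w lam *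
        (lin r * (potential q r ?M lam oo (fps_const q * fps_X)) - lin r * potential q r ?M lam))"
    unfolding Z_def Z_single_nth [OF q0 order_refl] comp sum_distrib_left
    by (simp only: sum_subtractf [symmetric] right_diff_distrib mult.left_commute)
  also have "\<dots> = (\<Sum>lam\<in>partitions_of ?M. ?w lam * - (fps_X *
      (\<Sum>i<?M. fps_const (removal_coeff q r ?M lam i) * punctured_potential q r ?M lam i)))"
  proof (rule sum.cong [OF refl])
    fix lam assume lam: "lam \<in> partitions_of ?M"
    have "\<forall>i\<ge>?M. lam i = 0" using partitions_of_zero [OF lam] by blast
    then show "?w lam * (lin r * (potential q r ?M lam oo (fps_const q * fps_X)) - lin r * potential q r ?M lam)
      = ?w lam * - (fps_X * (\<Sum>i<?M. fps_const (removal_coeff q r ?M lam i) * punctured_potential q r ?M lam i))"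
      by (simp only: potential_shift_up [OF q partitions_of_antimono [OF lam]])
  qed
  also have "\<dots> = - (fps_X * (\<Sum>lam\<in>partitions_of ?M. \<Sum>i<?M.
      fps_const ((schur_rho r lam)\<^sup>2 * removal_coeff q r ?M lam i) * punctured_potential q r ?M lam i))"
    by (simp only: sum_distrib_left sum_negf mult_minus_right fps_const_mult [symmetric] mult_ac)
  finally have up: "lin r * (Z ?M oo (fps_const q * fps_X)) - lin r * Z ?M
    = - (fps_X * (\<Sum>lam\<in>partitions_of ?M. \<Sum>i<?M.
      fps_const ((schur_rho r lam)\<^sup>2 * removal_coeff q r ?M lam i) * punctured_potential q r ?M lam i))" .
  \<comment> \<open>\<open>Suc m\<close> rows for the undilated term and \<open>m\<close> for the
    dilated one, so that \<open>potential_shift_down\<close> applies.\<close>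
  have Zm: "Z m = (\<Sum>mu\<in>partitions_of m. ?w mu * potential q r ?M mu)"
    "Z m = (\<Sum>mu\<in>partitions_of m. ?w mu * potential q r m mu)"
    unfolding Z_def by (simp_all add: Z_single_nth q0)
  have "fps_const r * fps_X * Z m
      + fps_X\<^sup>2 * inverse (lin (inverse r)) * (Z m oo (fps_const (inverse q) * fps_X))
    = (\<Sum>mu\<in>partitions_of m. ?w mu * (fps_const r * fps_X * potential q r ?M mu
      + fps_X\<^sup>2 * inverse (lin (inverse r)) * (potential q r m mu oo (fps_const (inverse q) * fps_X))))"
    by (subst Zm(1), subst Zm(2))
      (simp only: comp sum_distrib_left sum.distrib [symmetric] distrib_left mult.left_commute)
  also have "\<dots> = (\<Sum>mu\<in>partitions_of m. ?w mu * (fps_X *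
      (\<Sum>i<?M. fps_const (addition_coeff q r m mu i) * punctured_potential q r ?M mu i)))"
  proof (rule sum.cong [OF refl])
    fix mu assume mu: "mu \<in> partitions_of m"
    have "\<forall>i\<ge>m. mu i = 0" using partitions_of_zero [OF mu] by blast
    then show "?w mu * (fps_const r * fps_X * potential q r ?M mu
      + fps_X\<^sup>2 * inverse (lin (inverse r)) * (potential q r m mu oo (fps_const (inverse q) * fps_X)))
      = ?w mu * (fps_X * (\<Sum>i<?M. fps_const (addition_coeff q r m mu i) * punctured_potential q r ?M mu i))"
      by (simp only: potential_shift_down [OF q partitions_of_antimono [OF mu]])
  qed
  also have "\<dots> = fps_X * (\<Sum>mu\<in>partitions_of m. \<Sum>i<?M.
      fps_const ((schur_rho r mu)\<^sup>2 * addition_coeff q r m mu i) * punctured_potential q r ?M mu i)"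
    by (simp only: sum_distrib_left fps_const_mult [symmetric] mult_ac)
  finally have down: "fps_const r * fps_X * Z m
      + fps_X\<^sup>2 * inverse (lin (inverse r)) * (Z m oo (fps_const (inverse q) * fps_X))
    = fps_X * (\<Sum>mu\<in>partitions_of m. \<Sum>i<?M.
      fps_const ((schur_rho r mu)\<^sup>2 * addition_coeff q r m mu i) * punctured_potential q r ?M mu i)" .
  show ?thesis
    unfolding up down sum_remove_box_eq_sum_add_box [OF q] by simp
qed

theorem theorem4:
  fixes q r :: complex
  assumes "0 < norm q" and "norm q < 1" and "r\<^sup>2 = q"
  shows "A_op q r (Z_single q r) - Z_single q r = 0"
proof (rule fps_ext)
  have q0: "q \<noteq> 0" using assms(1) by auto
  let ?Z = "fps_nth (Z_single q r)"
  fix n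
  show "fps_nth (A_op q r (Z_single q r) - Z_single q r) n = fps_nth 0 n"
  proof (cases n)
    case 0
    \<comment> \<open>With no rows the potential is 1, so this coefficient is constant in x and
      fixed by the dilation.\<close>
    have "?Z 0 = fps_const (\<Sum>lam\<in>partitions_of 0. (schur_rho r lam)\<^sup>2)"
    proof (rule fps_ext)
      fix k
      show "fps_nth (?Z 0) k = fps_nth (fps_const (\<Sum>lam\<in>partitions_of 0. (schur_rho r lam)\<^sup>2)) k"
        unfolding Z_single_nth [OF q0 order_refl]
        by (cases k) (simp_all add: potential_def fps_sum_nth)
    qed
    then have "?Z 0 oo (fps_const q * fps_X) = ?Z 0" by (simp only: fps_const_compose)
    then show ?thesis
      by (simp add: 0 A_op_def q_pow_D_def mult.assoc algebra_simps)
  next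
    case (Suc m)
    have X_mult: "fps_nth (fps_X * (fps_const c :: complex fps fps) * F) (Suc m) = c * fps_nth F m" for c F
      by (simp add: mult.assoc)
    have const_mult: "fps_nth (fps_const c * F) k = c * fps_nth F k" for c :: "complex fps" and F k
      by simp
    have "fps_nth (A_op q r (Z_single q r) - Z_single q r) (Suc m)
      = lin r * (?Z (Suc m) oo (fps_const q * fps_X)) + fps_const r * fps_X * ?Z (Suc m)
        + fps_const r * fps_X * ?Z m
        + fps_X\<^sup>2 * inverse (lin (inverse r)) * (?Z m oo (fps_const (inverse q) * fps_X)) - ?Z (Suc m)"
      unfolding A_op_def q_pow_D_def fps_sub_nth fps_add_nth X_mult const_mult fps_nth_Abs_fps ..
    \<comment> \<open>The terms q^(1/2) x and -1 combine to -(1 - q^(1/2) x).\<close>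
    also have "\<dots> = lin r * (?Z (Suc m) oo (fps_const q * fps_X)) - lin r * ?Z (Suc m)
      + (fps_const r * fps_X * ?Z m
        + fps_X\<^sup>2 * inverse (lin (inverse r)) * (?Z m oo (fps_const (inverse q) * fps_X)))"
      by (simp add: left_diff_distrib)
    also have "\<dots> = 0" by (rule Z_single_recursion [OF assms])
    finally show ?thesis using Suc by simp
  qed
qed

end
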